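(* Let $q$ be a prime power, let $n\ge 1$ be an integer dividing $q-1$, and let $\alpha\in\mathbb{F}_q$ be a primitive $n$-th root of unity. Let $K=\mathbb{F}_q(x)$ be the field of rational functions over $\mathbb{F}_q$, and let $u\in K$ be nonzero and such that $u\neq w^d$ for every divisor $d>1$ of $n$ and every $w\in K$. Let $L=K[y]$, where $y$ is a root of $Y^n-u$. Then $L$ is a cyclic Galois extension of $K$ of degree $n$, with $K$-basis $(1,y,\dots,y^{n-1})$, and its Galois group is generated by the $K$-automorphism $\theta$ determined by $\theta(y)=\alpha y$. Moreover, for every integer $\kappa$ with $1\le \kappa\le n$, let $C_\kappa\subseteq L^n$ be the $L$-linear code generated by the rows of the $\kappa\times n$ matrix $$G=\left(\theta^{i}(y^{j})\right)_{0\le i\le \kappa-1,\;0\le j\le n-1}.$$ Then $C_\kappa$ is a Maximum Rank Distance code over $L$ of dimension $\kappa$, i.e. its minimum rank distance is $n-\kappa+1$. In particular, for every nonzero codeword $c\in C_\kappa$, the $n\times n$ matrix $M_c$ with entries in $\mathbb{F}_q(x)$ satisfies $$\operatorname{rank}_{\mathbb{F}_q(x)} M_c\ \ge\ n-\kappa+1 .$$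
   Context: For $c=(c_1,\dots,c_n)\in L^n$, write $c_i=\sum_{j=1}^{n}c_{i,j}\,y^{j-1}$ with $c_{i,j}\in K=\mathbb{F}_q(x)$, and let $M_c$ be the $n\times n$ matrix of the coefficients $c_{i,j}$ (its rank does not depend on whether $i$ indexes rows or columns). The rank weight of $c$ is $w(c)=\operatorname{rank}_K(M_c)$, and the rank distance on $L^n$ is $d(c,c')=w(c-c')$. The minimum rank distance of a nonzero $L$-linear code $C\subseteq L^n$ is the minimum of $w(c)$ over nonzero $c\in C$. An $L$-linear code $C\subseteq L^n$ of $L$-dimension $\kappa$ and minimum rank distance $d$ satisfies $d\le n-\kappa+1$ (Singleton bound); it is called a Maximum Rank Distance (MRD) code if $d=n-\kappa+1$. *)

theory Defs
  imports
    "HOL-Computational_Algebra.Computational_Algebra"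
    "HOL-Algebra.Elementary_Groups"
    "Jordan_Normal_Form.DL_Rank"
begin

section \<open>Field extensions\<close>

text \<open>
  A field extension \<open>L/K\<close> is given by two field types and a field homomorphism
  \<open>\<iota> :: 'k \<Rightarrow> 'l\<close> embedding \<open>K\<close> into \<open>L\<close>; this makes \<open>L\<close> a \<open>K\<close>-vector space.
\<close>

definition ext_scale :: "('k::field \<Rightarrow> 'l::field) \<Rightarrow> 'k \<Rightarrow> 'l \<Rightarrow> 'l" where
  "ext_scale \<iota> a z = \<iota> a * z"

definition ext_poly :: "('k::field \<Rightarrow> 'l::field) \<Rightarrow> 'k poly \<Rightarrow> 'l \<Rightarrow> 'l" where
  "ext_poly \<iota> p z = poly (map_poly \<iota> p) z"

definition finite_ext :: "('k::field \<Rightarrow> 'l::field) \<Rightarrow> bool" where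
  "finite_ext \<iota> \<longleftrightarrow> (\<exists>B. finite B \<and> Modules.module.span (ext_scale \<iota>) B = UNIV)"

definition ext_degree :: "('k::field \<Rightarrow> 'l::field) \<Rightarrow> nat" where
  "ext_degree \<iota> = Vector_Spaces.vector_space.dim (ext_scale \<iota>) (UNIV :: 'l set)"

definition is_ext_basis :: "('k::field \<Rightarrow> 'l::field) \<Rightarrow> nat \<Rightarrow> (nat \<Rightarrow> 'l) \<Rightarrow> bool" where
  "is_ext_basis \<iota> n b \<longleftrightarrow>
     inj_on b {..<n} \<and>
     \<not> Modules.module.dependent (ext_scale \<iota>) (b ` {..<n}) \<and>
     Modules.module.span (ext_scale \<iota>) (b ` {..<n}) = UNIV"

definition normal_ext :: "('k::field \<Rightarrow> 'l::field) \<Rightarrow> bool" where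
  "normal_ext \<iota> \<longleftrightarrow>
     (\<forall>z. \<exists>p. p \<noteq> 0 \<and> ext_poly \<iota> p z = 0) \<and>
     (\<forall>p. Factorial_Ring.irreducible p \<longrightarrow> (\<exists>z. ext_poly \<iota> p z = 0) \<longrightarrow>
        (\<exists>a zs. map_poly \<iota> p = Polynomial.smult a (\<Prod>z\<leftarrow>zs. [:- z, 1:])))"

text \<open>
  For irreducible \<open>p\<close> with root \<open>z\<close>, \<open>p\<close> is the minimal polynomial of \<open>z\<close> up to a unit.
\<close>

definition separable_ext :: "('k::field \<Rightarrow> 'l::field) \<Rightarrow> bool" where
  "separable_ext \<iota> \<longleftrightarrow>
     (\<forall>z. \<exists>p. Factorial_Ring.irreducible p \<and> ext_poly \<iota> p z = 0 \<and> coprime p (pderiv p))"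

definition galois_ext :: "('k::field \<Rightarrow> 'l::field) \<Rightarrow> bool" where
  "galois_ext \<iota> \<longleftrightarrow> field_hom \<iota> \<and> finite_ext \<iota> \<and> normal_ext \<iota> \<and> separable_ext \<iota>"

definition ext_auts :: "('k::field \<Rightarrow> 'l::field) \<Rightarrow> ('l \<Rightarrow> 'l) set" where
  "ext_auts \<iota> = {\<sigma>. field_hom \<sigma> \<and> bij \<sigma> \<and> (\<forall>a. \<sigma> (\<iota> a) = \<iota> a)}"

definition galois_group :: "('k::field \<Rightarrow> 'l::field) \<Rightarrow> ('l \<Rightarrow> 'l) monoid" where
  "galois_group \<iota> = \<lparr>carrier = ext_auts \<iota>, mult = (\<circ>), one = id\<rparr>"

lemma vector_space_ext_scale:
  assumes "field_hom \<iota>"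
  shows "Vector_Spaces.vector_space (ext_scale \<iota>)"
proof -
  interpret field_hom \<iota> by fact
  show ?thesis
    by unfold_locales (auto simp: ext_scale_def algebra_simps hom_distribs)
qed

lemma group_galois_group:
  fixes \<iota> :: "'k::field \<Rightarrow> 'l::field"
  shows "Group.group (galois_group \<iota>)"
proof (rule groupI)
  fix \<sigma> assume "\<sigma> \<in> carrier (galois_group \<iota>)"
  then have hom: "field_hom \<sigma>" and bij: "bij \<sigma>" and fixes_K: "\<And>a. \<sigma> (\<iota> a) = \<iota> a"
    by (auto simp: galois_group_def ext_auts_def)
  interpret field_hom \<sigma> by (fact hom)
  define \<rho> where "\<rho> = inv_into UNIV \<sigma>"
  have \<sigma>_inv: "\<sigma> (\<rho> z) = z" for z
    using bij by (simp add: \<rho>_def bij_is_surj surj_f_inv_f)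
  have inv_\<sigma>: "\<rho> (\<sigma> z) = z" for z
    using bij by (simp add: \<rho>_def bij_is_inj)
  have "\<rho> 0 = 0" "\<rho> 1 = 1"
    using inv_\<sigma>[of 0] inv_\<sigma>[of 1] by (simp_all add: hom_distribs)
  moreover have "\<rho> (x + y) = \<rho> x + \<rho> y" for x y
    using inv_\<sigma>[of "\<rho> x + \<rho> y"] by (simp add: hom_add \<sigma>_inv)
  moreover have "\<rho> (x * y) = \<rho> x * \<rho> y" for x y
    using inv_\<sigma>[of "\<rho> x * \<rho> y"] by (simp add: hom_mult \<sigma>_inv)
  ultimately have "field_hom (\<rho>)"
    by unfold_locales auto
  moreover have "bij (\<rho>)"
    using bij unfolding \<rho>_def by (rule bij_imp_bij_inv)
  moreover have "\<rho> (\<iota> a) = \<iota> a" for a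
    using inv_\<sigma>[of "\<iota> a"] by (simp add: fixes_K)
  moreover have "\<rho> \<circ> \<sigma> = id"
    using inv_\<sigma> by auto
  ultimately show "\<exists>\<tau>\<in>carrier (galois_group \<iota>). \<tau> \<otimes>\<^bsub>galois_group \<iota>\<^esub> \<sigma> = \<one>\<^bsub>galois_group \<iota>\<^esub>"
    by (auto simp: galois_group_def ext_auts_def)
next
  fix \<sigma> \<tau> assume "\<sigma> \<in> carrier (galois_group \<iota>)" "\<tau> \<in> carrier (galois_group \<iota>)"
  then have hom: "field_hom \<sigma>" "field_hom \<tau>" and rest: "bij \<sigma>" "bij \<tau>" 
      "\<And>a. \<sigma> (\<iota> a) = \<iota> a" "\<And>a. \<tau> (\<iota> a) = \<iota> a"
    by (auto simp: galois_group_def ext_auts_def)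
  interpret s: field_hom \<sigma> by (fact hom)
  interpret t: field_hom \<tau> by (fact hom)
  have "field_hom (\<sigma> \<circ> \<tau>)"
    by unfold_locales (auto simp: s.hom_zero s.hom_one s.hom_add s.hom_mult t.hom_zero t.hom_one t.hom_add t.hom_mult)
  with rest show "\<sigma> \<otimes>\<^bsub>galois_group \<iota>\<^esub> \<tau> \<in> carrier (galois_group \<iota>)"
    by (auto simp: galois_group_def ext_auts_def bij_comp)
next
  have "field_hom (id :: 'l \<Rightarrow> 'l)" by unfold_locales auto
  then show "\<one>\<^bsub>galois_group \<iota>\<^esub> \<in> carrier (galois_group \<iota>)"
    by (auto simp: galois_group_def ext_auts_def)
qed (auto simp: galois_group_def)

definition primitive_root_of_unity :: "nat \<Rightarrow> 'a::field \<Rightarrow> bool" where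
  "primitive_root_of_unity n a \<longleftrightarrow> a ^ n = 1 \<and> (\<forall>k. 0 < k \<and> k < n \<longrightarrow> a ^ k \<noteq> 1)"


section \<open>Rank-metric codes\<close>

text \<open>
  Codes are sets of vectors in \<open>carrier_vec n\<close> over \<open>L\<close>. The definite description is
  meaningful when \<open>1, y, \<dots>, y ^ (n - 1)\<close> is a \<open>K\<close>-basis of \<open>L\<close>; row \<open>i\<close> then holds
  the coordinates of the \<open>i\<close>-th entry of \<open>c\<close>, with all indices starting from \<open>0\<close>.
\<close>

definition coord_mat :: "('k::field \<Rightarrow> 'l::field) \<Rightarrow> 'l \<Rightarrow> nat \<Rightarrow> 'l vec \<Rightarrow> 'k mat" where
  "coord_mat \<iota> y n c =
     (THE M. M \<in> carrier_mat n n \<and>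
        (\<forall>i<n. c $ i = (\<Sum>j<n. \<iota> (M $$ (i, j)) * y ^ j)))"

definition rank_weight :: "('k::field \<Rightarrow> 'l::field) \<Rightarrow> 'l \<Rightarrow> nat \<Rightarrow> 'l vec \<Rightarrow> nat" where
  "rank_weight \<iota> y n c = vec_space.rank n (coord_mat \<iota> y n c)"

definition linear_code :: "nat \<Rightarrow> 'l::field vec set \<Rightarrow> bool" where
  "linear_code n C \<longleftrightarrow> VectorSpace.subspace class_ring C (module_vec TYPE('l) n)"

definition code_dim :: "nat \<Rightarrow> 'l::field vec set \<Rightarrow> nat" where
  "code_dim n C = VectorSpace.vectorspace.dim class_ring ((module_vec TYPE('l) n)\<lparr>carrier := C\<rparr>)"

definition min_rank_distance ::
    "('k::field \<Rightarrow> 'l::field) \<Rightarrow> 'l \<Rightarrow> nat \<Rightarrow> 'l vec set \<Rightarrow> nat" where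
  "min_rank_distance \<iota> y n C = Inf (rank_weight \<iota> y n ` (C - {0\<^sub>v n}))"

definition MRD_code ::
    "('k::field \<Rightarrow> 'l::field) \<Rightarrow> 'l \<Rightarrow> nat \<Rightarrow> 'l vec set \<Rightarrow> bool" where
  "MRD_code \<iota> y n C \<longleftrightarrow>
     linear_code n C \<and> C \<noteq> {0\<^sub>v n} \<and> min_rank_distance \<iota> y n C = n - code_dim n C + 1"

definition generator_mat :: "('l::field \<Rightarrow> 'l) \<Rightarrow> 'l \<Rightarrow> nat \<Rightarrow> nat \<Rightarrow> 'l mat" where
  "generator_mat \<theta> y \<kappa> n = mat \<kappa> n (\<lambda>(i, j). (\<theta> ^^ i) (y ^ j))"

definition generated_code :: "nat \<Rightarrow> 'l::field mat \<Rightarrow> 'l vec set" where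
  "generated_code n G = vec_space.row_space n G"

end

theory Submission
  imports Defs "Jordan_Normal_Form.Char_Poly"
begin

text \<open>
  If \<open>p\<close> is the minimal polynomial of \<open>y\<close>, then \<open>p\<close> divides \<open>Y ^ n - u\<close>, whose roots are the \<open>\<beta> ^ i * y\<close> for
  the primitive \<open>n\<close>-th root of unity \<open>\<beta>\<close>, so the constant term of \<open>p\<close> is a multiple of \<open>y ^ degree p\<close>
  by an element of \<open>K\<close>. As \<open>u\<close> is not a proper power, this forces \<open>degree p = n\<close>.
  The entries of a codeword are \<open>f (y ^ j)\<close> for an operator \<open>f = (\<Sum>i<\<kappa>. a i * \<theta> ^^ i)\<close>, and its matrix is the
  matrix of \<open>f\<close> as a \<open>K\<close>-linear map. Such an \<open>f\<close>, if nonzero, has a kernel of dimension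
  at most \<open>\<kappa> - 1\<close>, which gives the lower bound on the rank. A codeword whose first \<open>\<kappa> - 1\<close> entries
  vanish attains it.
\<close>

section \<open>Polynomials over field extensions\<close>

context field_hom
begin

interpretation map_poly_hom: map_poly_idom_hom hom ..

lemma hom_divide: "hom (a / b) = hom a / hom b"
  by (simp add: divide_inverse hom_mult hom_inverse)

lemma ext_poly_0 [simp]: "ext_poly hom 0 z = 0"
  by (simp add: ext_poly_def)

lemma ext_poly_1 [simp]: "ext_poly hom 1 z = 1"
  by (simp add: ext_poly_def)

lemma ext_poly_const [simp]: "ext_poly hom [:a:] z = hom a"
  by (simp add: ext_poly_def hom_distribs)

lemma ext_poly_monom [simp]: "ext_poly hom (monom a i) z = hom a * z ^ i"
  by (simp add: ext_poly_def poly_monom map_poly_monom)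

lemma ext_poly_add [simp]: "ext_poly hom (p + q) z = ext_poly hom p z + ext_poly hom q z"
  by (simp add: ext_poly_def map_poly_hom.hom_add)

lemma ext_poly_diff [simp]: "ext_poly hom (p - q) z = ext_poly hom p z - ext_poly hom q z"
  by (simp add: ext_poly_def map_poly_hom.hom_minus)

lemma ext_poly_mult [simp]: "ext_poly hom (p * q) z = ext_poly hom p z * ext_poly hom q z"
  by (simp add: ext_poly_def map_poly_hom.hom_mult)

lemma ext_poly_smult [simp]: "ext_poly hom (Polynomial.smult a p) z = hom a * ext_poly hom p z"
  by (simp add: ext_poly_def map_poly_hom_smult)

lemma ext_poly_sum [simp]: "ext_poly hom (\<Sum>i\<in>I. p i) z = (\<Sum>i\<in>I. ext_poly hom (p i) z)"
  by (induction I rule: infinite_finite_induct) auto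

lemma ext_poly_as_sum:
  assumes "degree p < n"
  shows "ext_poly hom p z = (\<Sum>i<n. hom (coeff p i) * z ^ i)"
proof -
  have "p = (\<Sum>i<n. monom (coeff p i) i)"
    using assms by (intro poly_eqI) (auto simp: coeff_sum coeff_eq_0 not_less)
  then have "ext_poly hom p z = ext_poly hom (\<Sum>i<n. monom (coeff p i) i) z"
    by simp
  then show ?thesis
    by simp
qed

lemma hom_ext_poly:
  assumes "field_hom \<sigma>" "\<And>a. \<sigma> (hom a) = hom a"
  shows "\<sigma> (ext_poly hom p z) = ext_poly hom p (\<sigma> z)"
proof -
  interpret s: field_hom \<sigma> by fact
  show ?thesis
    unfolding ext_poly_as_sum[OF lessI] by (simp add: s.hom_sum s.hom_add s.hom_mult s.hom_power assms(2))
qed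

text \<open>A nonzero polynomial of least degree vanishing at \<open>z\<close> is scaled to be
  monic. Division with remainder makes it divide every other one, and of two factors the one
  vanishing at \<open>z\<close> already has full degree, so the other is a unit.\<close>

lemma ext_minimal_polynomial:
  assumes "p \<noteq> 0" "ext_poly hom p z = 0"
  obtains m where "monic m" "Factorial_Ring.irreducible m"
    "\<And>f. ext_poly hom f z = 0 \<longleftrightarrow> m dvd f"
proof -
  define P where "P d \<longleftrightarrow> (\<exists>f. f \<noteq> 0 \<and> ext_poly hom f z = 0 \<and> degree f = d)" for d
  define d where "d = (LEAST d. P d)"
  have "P (degree p)"
    using assms by (auto simp: P_def)
  then have "P d"
    unfolding d_def by (rule LeastI)
  then obtain f where f: "f \<noteq> 0" "ext_poly hom f z = 0" "degree f = d"
    by (auto simp: P_def)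
  have least: "d \<le> degree g" if "g \<noteq> 0" "ext_poly hom g z = 0" for g
    unfolding d_def by (rule Least_le) (use that in \<open>auto simp: P_def\<close>)
  define m where "m = Polynomial.smult (inverse (lead_coeff f)) f"
  have m: "m \<noteq> 0" "ext_poly hom m z = 0" "degree m = d" "monic m"
    using f(1,2) by (simp_all add: m_def flip: f(3))
  have iff: "ext_poly hom g z = 0 \<longleftrightarrow> m dvd g" for g
  proof
    assume g: "ext_poly hom g z = 0"
    have "g mod m = g - m * (g div m)"
      by (simp add: minus_mult_div_eq_mod)
    then have "ext_poly hom (g mod m) z = 0"
      by (simp only: ext_poly_diff ext_poly_mult) (simp add: g m)
    moreover have "g mod m = 0 \<or> degree (g mod m) < d"
      using degree_mod_less[OF m(1), of g] m(3) by simp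
    ultimately have "g mod m = 0"
      using least by fastforce
    then show "m dvd g" by (simp add: mod_eq_0_iff_dvd)
  qed (auto simp: m elim!: dvdE)
  have "Factorial_Ring.irreducible m"
  proof (rule Factorial_Ring.irreducibleI)
    show "m \<noteq> 0" by fact
    show "\<not> m dvd 1"
      using iff[of 1] by simp
    fix a b assume ab: "m = a * b"
    then have nz: "a \<noteq> 0" "b \<noteq> 0" using m(1) by auto
    have "ext_poly hom a z = 0 \<or> ext_poly hom b z = 0"
      using m(2) ab by simp
    then have "degree m \<le> degree a \<or> degree m \<le> degree b"
      using least nz m(3) by auto
    then have "degree a = 0 \<or> degree b = 0"
      using ab nz by (auto simp: degree_mult_eq)
    then show "a dvd 1 \<or> b dvd 1"
      using nz by (auto simp: is_unit_iff_degree)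
  qed
  then show thesis
    using that m iff by blast
qed

end

text \<open>Unique factorization by induction on \<open>A\<close>: a linear factor either divides
  \<open>p\<close>, and is cancelled on both sides, or it divides the cofactor. Monicity excludes a
  leftover constant.\<close>

lemma monic_dvd_prod_linear:
  fixes p :: "'a::field poly"
  assumes "finite A" "monic p" "p dvd (\<Prod>a\<in>A. [:- a, 1:])"
  shows "\<exists>S\<subseteq>A. p = (\<Prod>a\<in>S. [:- a, 1:])"
  using assms
proof (induction A arbitrary: p rule: finite_induct)
  case empty
  then have "p = 1"
    by (auto simp: poly_dvd_1 elim!: degree_eq_zeroE)
  then show ?case by auto
next
  case (insert a A)
  show ?case
  proof (cases "poly p a = 0")
    case True
    then obtain p' where p': "p = [:- a, 1:] * p'"
      by (auto simp: poly_eq_0_iff_dvd elim: dvdE)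
    have "monic p'"
      using insert.prems(1) unfolding p' lead_coeff_mult by simp
    moreover have "p' dvd (\<Prod>a\<in>A. [:- a, 1:])"
      using insert.prems(2) unfolding p' prod.insert[OF insert.hyps] dvd_mult_cancel_left by simp
    ultimately obtain S where S: "S \<subseteq> A" "p' = (\<Prod>a\<in>S. [:- a, 1:])"
      using insert.IH by blast
    have "p = (\<Prod>a\<in>insert a S. [:- a, 1:])"
      using S insert.hyps unfolding p' by (subst prod.insert) (auto intro: finite_subset)
    then show ?thesis using S(1) by blast
  next
    case False
    \<comment> \<open>Since \<open>a\<close> is not a root of \<open>p\<close>, it is a root of the
      cofactor \<open>k\<close>, so the factor for \<open>a\<close> cancels without touching
      \<open>p\<close>.\<close>
    obtain k where k: "[:- a, 1:] * (\<Prod>a\<in>A. [:- a, 1:]) = p * k"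
      using insert.prems(2) unfolding prod.insert[OF insert.hyps] by (rule dvdE)
    have "poly (p * k) a = 0"
      unfolding k[symmetric] by simp
    then have "poly k a = 0" using False by simp
    then obtain k' where "k = [:- a, 1:] * k'"
      unfolding poly_eq_0_iff_dvd by (rule dvdE)
    then have "[:- a, 1:] * (\<Prod>a\<in>A. [:- a, 1:]) = [:- a, 1:] * (p * k')"
      unfolding k by (simp only: mult_ac)
    then have "(\<Prod>a\<in>A. [:- a, 1:]) = p * k'"
      unfolding mult_cancel_left by simp
    then have "p dvd (\<Prod>a\<in>A. [:- a, 1:])" by simp
    then show ?thesis using insert.IH insert.prems(1) by blast
  qed
qed


section \<open>Rank and linear constraints\<close>

text \<open>This is the existence of a nontrivial solution of fewer than \<open>n\<close>
  homogeneous equations in \<open>n\<close> unknowns, obtained from the determinant of a square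
  matrix padded with zero rows.\<close>

lemma orthogonal_vec_exists:
  fixes ws :: "'a::field vec list"
  assumes "set ws \<subseteq> carrier_vec n" "length ws < n"
  obtains v where "v \<in> carrier_vec n" "v \<noteq> 0\<^sub>v n" "\<And>w. w \<in> set ws \<Longrightarrow> w \<bullet> v = 0"
proof -
  define k where "k = length ws"
  define B where "B = mat n n (\<lambda>(i, j). if i < k then ws ! i $ j else 0)"
  have B: "B \<in> carrier_mat n n" by (simp add: B_def)
  have "k < n" using assms(2) by (simp add: k_def)
  \<comment> \<open>Row \<open>k\<close> is the first padding row, so the transpose kills the
    corresponding unit vector and the determinant vanishes.\<close>
  have "B\<^sup>T *\<^sub>v unit_vec n k = 0\<^sub>v n"
    using \<open>k < n\<close> by (intro eq_vecI) (auto simp: B_def)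
  then have "det B\<^sup>T = 0"
    using \<open>k < n\<close> B by (subst det_0_iff_vec_prod_zero_field[of _ n]) (auto intro!: exI[of _ "unit_vec n k"])
  then have "det B = 0" using det_transpose[OF B] by simp
  then obtain v where v: "v \<in> carrier_vec n" "v \<noteq> 0\<^sub>v n" "B *\<^sub>v v = 0\<^sub>v n"
    using det_0_iff_vec_prod_zero_field[OF B] by auto
  have "w \<bullet> v = 0" if w: "w \<in> set ws" for w
  proof -
    obtain i where i: "i < k" "w = ws ! i"
      using w by (auto simp: in_set_conv_nth k_def)
    have "w = row B i"
      using i \<open>k < n\<close> assms(1) w by (intro eq_vecI) (auto simp: B_def)
    then have "w \<bullet> v = (B *\<^sub>v v) $ i"
      using i \<open>k < n\<close> B by simp
    then show ?thesis
      using i \<open>k < n\<close> by (simp add: v)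
  qed
  with v that show thesis by blast
qed

context vec_space
begin

text \<open>A maximal independent set of columns spans all of them. The list form lets it be joined
  with further constraints or turned back into a matrix.\<close>

lemma rank_columns:
  assumes "M \<in> carrier_mat n nc"
  obtains ss where "distinct ss" "set ss \<subseteq> set (cols M)" "lin_indpt (set ss)"
    "set (cols M) \<subseteq> span (set ss)" "length ss = rank M"
proof -
  have cols: "set (cols M) \<subseteq> carrier_vec n"
    using assms cols_dim by blast
  have "lin_indpt {}"
    by (auto simp: lin_dep_def)
  then obtain S where S: "finite S" "maximal S (\<lambda>T. T \<subseteq> set (cols M) \<and> lin_indpt T)"
    using maximal_exists_superset[of "set (cols M)" "\<lambda>T. T \<subseteq> set (cols M) \<and> lin_indpt T" "{}"]
    by auto
  then have sub: "S \<subseteq> set (cols M)" and indpt: "lin_indpt S"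
    by (auto simp: maximal_def)
  have "c \<in> span S" if c: "c \<in> set (cols M)" for c
  proof (rule ccontr)
    assume notin: "c \<notin> span S"
    then have "lin_indpt (S \<union> {c})"
      using lin_dep_iff_in_span[of S c] sub indpt cols c span_mem[of S c] by auto
    then have "S \<union> {c} = S"
      using maximal_def[THEN iffD1, OF S(2)] sub c by auto
    then show False
      using notin span_mem[of S c] sub cols by auto
  qed
  moreover obtain ss where "set ss = S" "distinct ss"
    using finite_distinct_list[OF S(1)] by blast
  moreover have "rank M = card S"
    by (rule rank_card_indpt[OF assms S(2)])
  ultimately show thesis
    using that[of ss] sub indpt distinct_card[of ss] by auto
qed

lemma orthogonal_span:
  assumes "S \<subseteq> carrier_vec n" "v \<in> carrier_vec n" "\<And>s. s \<in> S \<Longrightarrow> s \<bullet> v = 0" "w \<in> span S"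
  shows "w \<bullet> v = 0"
proof -
  obtain a A where A: "finite A" "A \<subseteq> S" "w = lincomb a A"
    using assms(4) unfolding span_def by auto
  have "A \<subseteq> carrier_vec n" using A assms(1) by auto
  have "w \<bullet> v = (\<Sum>i<n. (\<Sum>s\<in>A. a s * s $ i) * v $ i)"
    unfolding A(3) scalar_prod_def using assms(2) \<open>A \<subseteq> carrier_vec n\<close>
    by (intro sum.cong) (auto simp: lincomb_index)
  also have "\<dots> = (\<Sum>s\<in>A. a s * (\<Sum>i<n. s $ i * v $ i))"
    unfolding sum_distrib_right sum_distrib_left by (subst sum.swap) (simp add: mult_ac)
  also have "\<dots> = (\<Sum>s\<in>A. a s * (s \<bullet> v))"
    using assms(2) unfolding scalar_prod_def by (simp add: atLeast0LessThan)
  also have "\<dots> = 0"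
    using A assms(3) by (intro sum.neutral) auto
  finally show ?thesis .
qed

text \<open>Otherwise a basis of the columns together with \<open>ws\<close> imposes fewer than
  \<open>n\<close> conditions, so some nonzero \<open>v\<close> meets them all. Orthogonality to the
  basis passes to every column through the span.\<close>

lemma le_rank_plus_constraints:
  assumes M: "M \<in> carrier_mat n nc" and ws: "set ws \<subseteq> carrier_vec n"
    and triv: "\<And>v. v \<in> carrier_vec n \<Longrightarrow> (\<And>w. w \<in> set ws \<Longrightarrow> w \<bullet> v = 0) \<Longrightarrow>
      (\<And>j. j < nc \<Longrightarrow> col M j \<bullet> v = 0) \<Longrightarrow> v = 0\<^sub>v n"
  shows "n \<le> rank M + length ws"
proof (rule ccontr)
  assume less: "\<not> n \<le> rank M + length ws"
  obtain ss where ss: "set ss \<subseteq> set (cols M)" "set (cols M) \<subseteq> span (set ss)" "length ss = rank M"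
    using rank_columns[OF M] by metis
  have cols: "set (cols M) \<subseteq> carrier_vec n"
    using M cols_dim by blast
  have "set (ws @ ss) \<subseteq> carrier_vec n" "length (ws @ ss) < n"
    using ws ss cols less by auto
  then obtain v where v: "v \<in> carrier_vec n" "v \<noteq> 0\<^sub>v n" "\<And>w. w \<in> set (ws @ ss) \<Longrightarrow> w \<bullet> v = 0"
    using orthogonal_vec_exists by blast
  have "col M j \<bullet> v = 0" if "j < nc" for j
  proof (rule orthogonal_span)
    show "col M j \<in> span (set ss)"
      using that M ss(2) by (auto simp: cols_def)
  qed (use v ss cols in auto)
  then have "v = 0\<^sub>v n"
    using v by (intro triv) auto
  then show False using v by simp
qed

text \<open>More than \<open>n - k\<close> independent columns would satisfy a nontrivial relation
  on their last \<open>n - k\<close> coordinates. The first \<open>k\<close> coordinates vanish, so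
  the relation would hold in full.\<close>

lemma rank_zero_rows_le:
  assumes M: "M \<in> carrier_mat n nc"
    and zero: "\<And>i j. i < k \<Longrightarrow> j < nc \<Longrightarrow> M $$ (i, j) = 0" and "k \<le> n"
  shows "rank M \<le> n - k"
proof (rule ccontr)
  assume less: "\<not> rank M \<le> n - k"
  obtain ss where ss: "distinct ss" "set ss \<subseteq> set (cols M)" "lin_indpt (set ss)" "length ss = rank M"
    using rank_columns[OF M] by metis
  have cols: "set (cols M) \<subseteq> carrier_vec n"
    using M cols_dim by blast
  define A where "A = mat_of_cols n ss"
  have A: "A \<in> carrier_mat n (rank M)"
    unfolding A_def ss(4)[symmetric] by simp
  \<comment> \<open>The vector \<open>v\<close> obtained below lists the coefficients of a linear
    relation among these columns.\<close>
  have colsA: "cols A = ss"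
    unfolding A_def by (rule cols_mat_of_cols) (use ss cols in auto)
  have rows: "set (map (row A) [k..<n]) \<subseteq> carrier_vec (rank M)" "length (map (row A) [k..<n]) < rank M"
    using A less by auto
  obtain v where v: "v \<in> carrier_vec (rank M)" "v \<noteq> 0\<^sub>v (rank M)"
     and orth: "\<And>w. w \<in> set (map (row A) [k..<n]) \<Longrightarrow> w \<bullet> v = 0"
    using orthogonal_vec_exists[OF rows] by blast
  have "A *\<^sub>v v = 0\<^sub>v n"
  proof (rule eq_vecI)
    fix i assume "i < dim_vec (0\<^sub>v n)"
    then have i: "i < n" by simp
    have "row A i \<bullet> v = 0"
    proof (cases "i < k")
      case True
      have "ss ! j $ i = 0" if j: "j < length ss" for j
      proof -
        have "ss ! j \<in> set (cols M)" using ss j by auto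
        then obtain l where "l < nc" "ss ! j = col M l"
          using M by (auto simp: cols_def)
        then show ?thesis using zero[OF True] M i by auto
      qed
      then have "row A i = 0\<^sub>v (rank M)"
        using i ss by (intro eq_vecI) (auto simp: A_def mat_of_cols_def)
      then show ?thesis using v by simp
    next
      case False
      then show ?thesis using i by (intro orth) auto
    qed
    then show "(A *\<^sub>v v) $ i = 0\<^sub>v n $ i"
      using i A by simp
  qed (use A in auto)
  then have "lin_dep (set (cols A))"
    using lin_depI[OF A v(1,2)] ss(1) colsA by simp
  then show False using ss(3) colsA by simp
qed

end


section \<open>Kummer extensions\<close>

text \<open>The assumption \<open>generates\<close> encodes \<open>L = K[y]\<close>. That Y^n - u is
  the minimal polynomial of \<open>y\<close> is derived from \<open>not_power\<close>, not
  assumed.\<close>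

locale kummer_extension = field_hom \<iota> for \<iota> :: "'k::field \<Rightarrow> 'l::field" +
  fixes n :: nat and \<beta> u :: 'k and y :: 'l
  assumes n_pos: "n \<ge> 1"
    and root: "primitive_root_of_unity n \<beta>"
    and u_nonzero: "u \<noteq> 0"
    and not_power: "\<And>d w. d dvd n \<Longrightarrow> d > 1 \<Longrightarrow> u \<noteq> w ^ d"
    and y_power: "y ^ n = \<iota> u"
    and generates: "range (\<lambda>p. ext_poly \<iota> p y) = UNIV"
begin

section \<open>Roots and factorization of Y^n - u\<close>

definition roots :: "'l set" where
  "roots = (\<lambda>i. \<iota> \<beta> ^ i * y) ` {..<n}"

lemma \<beta>_power_n: "\<beta> ^ n = 1"
  using root by (simp add: primitive_root_of_unity_def)

lemma \<beta>_nonzero: "\<beta> \<noteq> 0"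
  using \<beta>_power_n n_pos by (auto simp: power_0_left)

lemma \<beta>_power_neq_1: "0 < k \<Longrightarrow> k < n \<Longrightarrow> \<beta> ^ k \<noteq> 1"
  using root by (simp add: primitive_root_of_unity_def)

lemma y_nonzero: "y \<noteq> 0"
  using y_power u_nonzero n_pos by (auto simp: power_0_left)

lemma finite_roots: "finite roots"
  by (simp add: roots_def)

lemma card_roots: "card roots = n"
proof -
  have *: False if "i < j" "j < n" "\<iota> \<beta> ^ i * y = \<iota> \<beta> ^ j * y" for i j
  proof -
    have "\<iota> (\<beta> ^ i) = \<iota> (\<beta> ^ j)"
      using that y_nonzero by (simp add: hom_power)
    moreover have "\<beta> ^ j = \<beta> ^ i * \<beta> ^ (j - i)"
      using that by (simp flip: power_add)
    ultimately have "\<beta> ^ i * 1 = \<beta> ^ i * \<beta> ^ (j - i)"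
      by simp
    then have "\<beta> ^ (j - i) = 1"
      using \<beta>_nonzero by (subst (asm) mult_cancel_left) auto
    then show False
      using \<beta>_power_neq_1[of "j - i"] that by simp
  qed
  have "inj_on (\<lambda>i. \<iota> \<beta> ^ i * y) {..<n}"
    by (rule inj_onI) (metis * lessThan_iff linorder_neqE_nat)
  then show ?thesis
    by (simp add: roots_def card_image)
qed

lemma root_power: "r \<in> roots \<Longrightarrow> r ^ n = \<iota> u"
  using \<beta>_power_n
  by (auto simp: roots_def power_mult_distrib y_power power_mult[symmetric] mult.commute[of _ n] simp flip: hom_power)
     (simp add: power_mult)

lemma map_poly_kummer: "map_poly \<iota> (monom 1 n - [:u:]) = monom 1 n - [:\<iota> u:]"
  by (intro poly_eqI) (auto simp: coeff_pCons hom_distribs split: nat.split)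

text \<open>Both sides are monic of degree \<open>n\<close> and agree at the \<open>n\<close>
  distinct elements of \<open>roots\<close>, so their difference has more zeros than its degree
  allows.\<close>

lemma kummer_polynomial_factorization:
  "monom 1 n - [:\<iota> u:] = (\<Prod>r\<in>roots. [:- r, 1:])"
proof (rule poly_eqI_degree_lead_coeff[where n = n and A = roots])
  have deg: "degree (\<Prod>r\<in>roots. [:- r, 1:]) = n"
    by (subst degree_prod_sum_eq) (auto simp: card_roots)
  have "monic (\<Prod>r\<in>roots. [:- r, 1:])"
    by (rule monic_prod) auto
  then show "coeff (monom 1 n - [:\<iota> u:]) n = coeff (\<Prod>r\<in>roots. [:- r, 1:]) n"
    using deg n_pos by (auto simp: coeff_pCons split: nat.split)
  show "degree (\<Prod>r\<in>roots. [:- r, 1:]) \<le> n"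
    using deg by simp
  show "degree (monom 1 n - [:\<iota> u:]) \<le> n"
    by (intro degree_diff_le) (auto simp: degree_monom_le)
  show "poly (monom 1 n - [:\<iota> u:]) r = poly (\<Prod>r\<in>roots. [:- r, 1:]) r" if "r \<in> roots" for r
    using that root_power[OF that] finite_roots by (auto simp: poly_prod poly_monom)
qed (simp add: card_roots)

lemma roots_iff: "r \<in> roots \<longleftrightarrow> r ^ n = \<iota> u"
proof
  assume "r ^ n = \<iota> u"
  then have "poly (\<Prod>r\<in>roots. [:- r, 1:]) r = 0"
    unfolding kummer_polynomial_factorization[symmetric] by (simp add: poly_monom)
  then show "r \<in> roots"
    using finite_roots by (auto simp: poly_prod)
qed (rule root_power)

text \<open>Bezout turns \<open>y ^ d \<in> K\<close> into \<open>y ^ gcd d n \<in> K\<close>, which makes \<open>u\<close> an \<open>(n / gcd d n)\<close>-th power.\<close>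

lemma power_in_base_imp_dvd:
  assumes "y ^ d = \<iota> w"
  shows "n dvd d"
proof (cases "d = 0")
  case False
  define g where "g = gcd d n"
  \<comment> \<open>This form of Bezout has natural coefficients, so both sides can serve as
    exponents of \<open>y\<close>.\<close>
  obtain a b where ab: "d * a = n * b + g"
    using bezout_nat[OF False, of n] by (auto simp: g_def)
  define v where "v = w ^ a / u ^ b"
  have "\<iota> u ^ b * y ^ g = \<iota> w ^ a"
    using arg_cong[OF ab, of "\<lambda>e. y ^ e"] by (simp add: power_add power_mult y_power assms)
  then have yg: "y ^ g = \<iota> v"
    using u_nonzero by (simp add: v_def hom_divide hom_power field_simps)
  have "g dvd n" by (simp add: g_def)
  then have n: "n = g * (n div g)" by simp
  have "\<iota> u = \<iota> (v ^ (n div g))"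
    using y_power by (subst (asm) n) (simp add: power_mult yg hom_power)
  then have "u = v ^ (n div g)" by simp
  moreover have "n div g dvd n"
    using n by (metis dvd_triv_right)
  ultimately have "\<not> n div g > 1"
    using not_power by blast
  moreover have "n div g \<noteq> 0"
    using n n_pos by (metis mult_0_right not_one_le_zero)
  ultimately have "n div g = 1" by linarith
  then have "g = n" using n by simp
  then show ?thesis by (metis g_def gcd_dvd1)
qed simp

text \<open>This amounts to the irreducibility of Y^n - u over \<open>K\<close>, in the form needed
  for linear independence and for division with remainder.\<close>

lemma degree_ge_if_annihilates:
  assumes "p \<noteq> 0" "ext_poly \<iota> p y = 0"
  shows "n \<le> degree p"
proof -
  obtain m where m: "monic m" "Factorial_Ring.irreducible m"
    "\<And>f. ext_poly \<iota> f y = 0 \<longleftrightarrow> m dvd f"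
    using ext_minimal_polynomial[OF assms] by blast
  interpret map_poly_hom: map_poly_idom_hom \<iota> ..
  have "m dvd monom 1 n - [:u:]"
    unfolding m(3)[symmetric] by (simp add: y_power)
  then have "map_poly \<iota> m dvd (\<Prod>r\<in>roots. [:- r, 1:])"
    unfolding kummer_polynomial_factorization[symmetric] map_poly_kummer[symmetric]
    by (auto elim!: dvdE simp: map_poly_hom.hom_mult)
  moreover have "monic (map_poly \<iota> m)"
    using m(1) by simp
  ultimately obtain S where S: "S \<subseteq> roots" "map_poly \<iota> m = (\<Prod>r\<in>S. [:- r, 1:])"
    using monic_dvd_prod_linear[OF finite_roots] by blast
  have "finite S" using S(1) finite_roots by (rule finite_subset)
  have deg: "degree m = card S"
  proof -
    have "degree m = degree (map_poly \<iota> m)" by simp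
    also have "\<dots> = card S"
      unfolding S(2) by (subst degree_prod_sum_eq) auto
    finally show ?thesis .
  qed
  \<comment> \<open>Each root is \<open>y\<close> times a power of \<beta>, which lies in
    \<open>K\<close>; the constant term of \<open>m\<close> is therefore a nonzero scalar times a
    power of \<open>y\<close>.\<close>
  have "\<exists>b. b \<noteq> 0 \<and> (\<Prod>r\<in>S. - r) = \<iota> b * y ^ card S"
    using \<open>finite S\<close> S(1)
  proof (induction S rule: finite_induct)
    case empty
    show ?case by (auto intro!: exI[of _ 1])
  next
    case (insert r S)
    then obtain b i where "b \<noteq> 0" "(\<Prod>r\<in>S. - r) = \<iota> b * y ^ card S" "r = \<iota> \<beta> ^ i * y"
      by (auto simp: roots_def)
    then show ?case
      using insert.hyps \<beta>_nonzero
      by (auto intro!: exI[of _ "- (\<beta> ^ i) * b"] simp: hom_distribs)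
  qed
  then obtain b where b: "b \<noteq> 0" "(\<Prod>r\<in>S. - r) = \<iota> b * y ^ card S"
    by blast
  have "\<iota> (coeff m 0) = (\<Prod>r\<in>S. - r)"
    using arg_cong[OF S(2), of "\<lambda>p. poly p 0"] unfolding poly_prod by (simp add: poly_0_coeff_0)
  then have "y ^ card S = \<iota> (coeff m 0 / b)"
    using b by (simp add: hom_divide field_simps)
  then have "n dvd card S"
    by (rule power_in_base_imp_dvd)
  \<comment> \<open>An irreducible \<open>m\<close> is not a unit; this excludes the empty case
    \<open>n dvd 0\<close>.\<close>
  moreover have "card S \<noteq> 0"
    using m(2) deg by (metis is_unit_iff_degree irreducible_def)
  ultimately have "n \<le> degree m"
    using deg by (simp add: dvd_imp_le)
  also have "degree m \<le> degree p"
    using assms m(3) by (auto intro: dvd_imp_degree_le)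
  finally show ?thesis .
qed

section \<open>The power basis and its coordinates\<close>

lemma combination_eq_0_imp:
  assumes "(\<Sum>j<n. \<iota> (a j) * y ^ j) = 0" "j < n"
  shows "a j = 0"
proof -
  define p where "p = (\<Sum>j<n. monom (a j) j)"
  have coeff: "coeff p i = (if i < n then a i else 0)" for i
    by (auto simp: p_def coeff_sum)
  have "ext_poly \<iota> p y = 0"
    using assms by (simp add: p_def)
  moreover have "degree p < n"
    using n_pos coeff by (intro degree_lessI) auto
  ultimately have "p = 0"
    using degree_ge_if_annihilates[of p] by auto
  then show ?thesis
    using coeff[of j] assms(2) by simp
qed

text \<open>Choice is harmless for indices below \<open>n\<close>: \<open>coord_sum\<close> gives
  existence and \<open>coord_eqI\<close> uniqueness. Values at larger indices are
  unspecified.\<close>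

definition coord :: "'l \<Rightarrow> nat \<Rightarrow> 'k" where
  "coord z = (SOME a. z = (\<Sum>j<n. \<iota> (a j) * y ^ j))"

lemma degree_kummer: "degree (monom 1 n - [:u:]) = n"
proof -
  have eq: "monom 1 n - [:u:] = monom 1 n + [:- u:]"
    by simp
  show ?thesis
    unfolding eq using degree_add_eq_left[of "[:- u:]" "monom 1 n"] n_pos by (simp add: degree_monom_eq)
qed

text \<open>The remainder modulo Y^n - u also vanishes at \<open>y\<close> and has degree below
  \<open>n\<close>, hence is zero. This makes substitution of another root for \<open>y\<close> well
  defined.\<close>

lemma annihilates_imp_kummer_dvd:
  assumes "ext_poly \<iota> p y = 0"
  shows "monom 1 n - [:u:] dvd p"
proof -
  define f :: "'k poly" where "f = monom 1 n - [:u:]"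
  have "degree f = n"
    unfolding f_def by (rule degree_kummer)
  then have "f \<noteq> 0" using n_pos by auto
  have "p mod f = p - f * (p div f)"
    by (simp add: minus_mult_div_eq_mod)
  then have "ext_poly \<iota> (p mod f) y = 0"
    by (simp only: ext_poly_diff ext_poly_mult) (simp add: assms f_def y_power)
  then have "p mod f = 0"
    using degree_ge_if_annihilates[of "p mod f"] degree_mod_less[OF \<open>f \<noteq> 0\<close>, of p] \<open>degree f = n\<close>
    by fastforce
  then show ?thesis
    by (simp add: f_def mod_eq_0_iff_dvd)
qed

lemma coord_sum: "(\<Sum>j<n. \<iota> (coord z j) * y ^ j) = z"
proof -
  define f :: "'k poly" where "f = monom 1 n - [:u:]"
  obtain p where p: "z = ext_poly \<iota> p y"
    using generates by (metis UNIV_I imageE)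
  have "degree f = n"
    unfolding f_def by (rule degree_kummer)
  moreover from this have "f \<noteq> 0" using n_pos by auto
  ultimately have "degree (p mod f) < n"
    using n_pos degree_mod_less[of f p] by (cases "p mod f = 0") auto
  have "p = f * (p div f) + p mod f" by simp
  then have "z = ext_poly \<iota> (f * (p div f) + p mod f) y"
    using p by simp
  also have "\<dots> = ext_poly \<iota> (p mod f) y"
    by (simp only: ext_poly_add ext_poly_mult) (simp add: f_def y_power)
  also have "\<dots> = (\<Sum>j<n. \<iota> (coeff (p mod f) j) * y ^ j)"
    by (rule ext_poly_as_sum) fact
  finally show ?thesis
    unfolding coord_def by (rule someI[where P = "\<lambda>a. z = (\<Sum>j<n. \<iota> (a j) * y ^ j)", symmetric])
qed

lemma coord_eqI:
  assumes "z = (\<Sum>j<n. \<iota> (a j) * y ^ j)" "j < n"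
  shows "coord z j = a j"
proof -
  have "(\<Sum>j<n. \<iota> (coord z j - a j) * y ^ j) = 0"
    using coord_sum[of z] assms(1) by (simp add: hom_distribs left_diff_distrib sum_subtractf)
  from combination_eq_0_imp[OF this assms(2)] show ?thesis by simp
qed

lemma power_basis: "is_ext_basis \<iota> n (\<lambda>j. y ^ j)"
proof -
  interpret vs: vector_space "ext_scale \<iota>"
    by (rule vector_space_ext_scale) (rule field_hom_axioms)
  have inj: "inj_on (\<lambda>j. y ^ j) {..<n}"
  proof (rule inj_onI)
    fix i j assume ij: "i \<in> {..<n}" "j \<in> {..<n}" "y ^ i = y ^ j"
    \<comment> \<open>The coordinates of a power of \<open>y\<close> form a Kronecker delta, which
      recovers the exponent.\<close>
    have "coord (y ^ i) i = 1" 
      using ij by (subst coord_eqI[where a = "\<lambda>k. if k = i then 1 else 0"]) (auto simp: if_distrib if_distribR cong: if_cong)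
    moreover have "coord (y ^ j) i = (if i = j then 1 else 0)"
      using ij by (subst coord_eqI[where a = "\<lambda>k. if k = j then 1 else 0"]) (auto simp: if_distrib if_distribR cong: if_cong)
    ultimately show "i = j" using ij by (auto split: if_splits)
  qed
  have indep: "\<not> vs.dependent ((\<lambda>j. y ^ j) ` {..<n})"
  proof
    assume "vs.dependent ((\<lambda>j. y ^ j) ` {..<n})"
    then obtain c v where c: "v \<in> (\<lambda>j. y ^ j) ` {..<n}" "c v \<noteq> 0"
      "(\<Sum>v\<in>(\<lambda>j. y ^ j) ` {..<n}. ext_scale \<iota> (c v) v) = 0"
      by (subst (asm) vs.dependent_finite) auto
    then have "(\<Sum>j<n. \<iota> (c (y ^ j)) * y ^ j) = 0"
      by (simp add: sum.reindex[OF inj] ext_scale_def)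
    then have "c (y ^ j) = 0" if "j < n" for j
      using combination_eq_0_imp[of "\<lambda>j. c (y ^ j)"] that by blast
    then show False
      using c(1,2) by auto
  qed
  have "z \<in> vs.span ((\<lambda>j. y ^ j) ` {..<n})" for z
  proof -
    have "(\<Sum>j<n. ext_scale \<iota> (coord z j) (y ^ j)) \<in> vs.span ((\<lambda>j. y ^ j) ` {..<n})"
      by (intro vs.span_sum vs.span_scale vs.span_base) auto
    then show ?thesis using coord_sum[of z] by (simp add: ext_scale_def)
  qed
  then show ?thesis
    using inj indep by (auto simp: is_ext_basis_def)
qed

lemma finite_extension: "finite_ext \<iota>"
  using power_basis by (auto simp: finite_ext_def is_ext_basis_def)

lemma degree_extension: "ext_degree \<iota> = n"
proof -
  interpret vs: vector_space "ext_scale \<iota>"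
    by (rule vector_space_ext_scale) (rule field_hom_axioms)
  have "vs.dim UNIV = card ((\<lambda>j. y ^ j) ` {..<n})"
    using power_basis by (intro vs.dim_eq_card) (auto simp: is_ext_basis_def)
  then show ?thesis
    using power_basis by (simp add: ext_degree_def is_ext_basis_def card_image)
qed

section \<open>Automorphisms of L over K and the image of y\<close>

lemma automorphism_root: "\<sigma> \<in> ext_auts \<iota> \<Longrightarrow> \<sigma> y \<in> roots"
proof -
  assume \<sigma>: "\<sigma> \<in> ext_auts \<iota>"
  then interpret s: field_hom \<sigma> by (simp add: ext_auts_def)
  show ?thesis
    using \<sigma> by (simp add: roots_iff ext_auts_def y_power flip: s.hom_power)
qed

lemma automorphism_eqI:
  assumes "\<sigma> \<in> ext_auts \<iota>" "\<tau> \<in> ext_auts \<iota>" "\<sigma> y = \<tau> y"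
  shows "\<sigma> = \<tau>"
proof
  fix z
  obtain p where "z = ext_poly \<iota> p y"
    using generates by (metis UNIV_I imageE)
  then show "\<sigma> z = \<tau> z"
    using assms by (simp add: ext_auts_def hom_ext_poly)
qed

text \<open>Sending the value of \<open>p\<close> at \<open>y\<close> to its value at
  \<open>r\<close> is well defined: two polynomials with the same value at \<open>y\<close> differ
  by a multiple of Y^n - u, which also vanishes at \<open>r\<close>.\<close>

lemma automorphism_exists:
  assumes "r \<in> roots"
  obtains \<sigma> where "\<sigma> \<in> ext_auts \<iota>" "\<sigma> y = r"
proof -
  define \<sigma> where "\<sigma> z = ext_poly \<iota> (SOME p. z = ext_poly \<iota> p y) r" for z
  have \<sigma>: "\<sigma> (ext_poly \<iota> p y) = ext_poly \<iota> p r" for p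
  proof -
    define p' where "p' = (SOME p'. ext_poly \<iota> p y = ext_poly \<iota> p' y)"
    have "ext_poly \<iota> p y = ext_poly \<iota> p' y"
      unfolding p'_def by (rule someI) (rule refl)
    then have "ext_poly \<iota> (p - p') y = 0" by simp
    then have "monom 1 n - [:u:] dvd p - p'"
      by (rule annihilates_imp_kummer_dvd)
    then obtain h where h: "p - p' = (monom 1 n - [:u:]) * h" ..
    have "ext_poly \<iota> (p - p') r = 0"
      unfolding h ext_poly_mult using root_power[OF assms] by simp
    then show ?thesis by (simp add: \<sigma>_def p'_def)
  qed
  have rep: "\<exists>p. z = ext_poly \<iota> p y" for z
    using generates by (metis UNIV_I imageE)
  have hom: "field_hom \<sigma>"
  proof
    show "\<sigma> 0 = 0" "\<sigma> 1 = 1"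
      using \<sigma>[of 0] \<sigma>[of 1] by simp_all
    fix x z
    obtain p p' where "x = ext_poly \<iota> p y" "z = ext_poly \<iota> p' y"
      using rep by metis
    then show "\<sigma> (x + z) = \<sigma> x + \<sigma> z" "\<sigma> (x * z) = \<sigma> x * \<sigma> z"
      using \<sigma>[of "p + p'"] \<sigma>[of "p * p'"] by (simp_all add: \<sigma>)
  qed
  then interpret s: field_hom \<sigma> .
  have fixes_base: "\<sigma> (\<iota> a) = \<iota> a" for a
    using \<sigma>[of "[:a:]"] by simp
  have \<sigma>_y: "\<sigma> y = r"
    using \<sigma>[of "monom 1 1"] by simp
  obtain i where r: "r = \<iota> \<beta> ^ i * y"
    using assms by (auto simp: roots_def)
  \<comment> \<open>An explicit preimage of \<open>y\<close> gives surjectivity, since every element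
    is a polynomial value at \<open>y\<close> and \<sigma> fixes the coefficients.\<close>
  have "\<sigma> (\<iota> (inverse (\<beta> ^ i)) * y) = y"
  proof -
    have "\<sigma> (\<iota> (inverse (\<beta> ^ i)) * y) = \<iota> (inverse (\<beta> ^ i) * \<beta> ^ i) * y"
      unfolding s.hom_mult fixes_base \<sigma>_y r by (simp only: hom_mult hom_power mult.assoc)
    then show ?thesis using \<beta>_nonzero by simp
  qed
  then have "\<sigma> (ext_poly \<iota> p (\<iota> (inverse (\<beta> ^ i)) * y)) = ext_poly \<iota> p y" for p
    using hom fixes_base by (simp add: hom_ext_poly)
  then have "surj \<sigma>"
    using rep by (metis surjI surj_def)
  then have "bij \<sigma>"
    using s.inj_f by (simp add: bij_def)
  then show thesis
    using hom fixes_base \<sigma>_y by (intro that[of \<sigma>]) (simp_all add: ext_auts_def)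
qed

lemma ex1_generator: "\<exists>!\<theta>. \<theta> \<in> ext_auts \<iota> \<and> \<theta> y = \<iota> \<beta> * y"
proof -
  have "\<iota> \<beta> * y \<in> roots"
    using \<beta>_power_n by (simp add: roots_iff power_mult_distrib y_power flip: hom_power)
  then obtain \<theta> where "\<theta> \<in> ext_auts \<iota>" "\<theta> y = \<iota> \<beta> * y"
    by (rule automorphism_exists)
  then show ?thesis
    using automorphism_eqI by (intro ex1I[of _ \<theta>]) auto
qed

end

text \<open>Summation by parts, later used with \<open>t i = (\<theta> ^^ i) w\<close> to divide an
  operator by \<theta> - 1; the last term is the remainder, governed by the sum of the
  coefficients.\<close>

lemma abel_summation:
  fixes c t :: "nat \<Rightarrow> 'c::comm_ring_1"
  shows "(\<Sum>i<m. - (\<Sum>j<Suc i. c j) * (t (Suc i) - t i)) = (\<Sum>i<m. c i * t i) - (\<Sum>j<m. c j) * t m"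
  by (induction m) (simp_all add: algebra_simps)

locale kummer_automorphism = kummer_extension +
  fixes \<theta> :: "'b \<Rightarrow> 'b"
  assumes automorphism: "\<theta> \<in> ext_auts \<iota>"
    and \<theta>_y: "\<theta> y = \<iota> \<beta> * y"
begin

sublocale \<theta>: field_hom \<theta>
  using automorphism by (simp add: ext_auts_def)

lemma \<theta>_base [simp]: "\<theta> (\<iota> a) = \<iota> a"
  using automorphism by (simp add: ext_auts_def)

section \<open>Powers of the generator and the cyclic Galois group\<close>

lemma funpow_automorphism: "\<theta> ^^ i \<in> ext_auts \<iota>"
proof (induction i)
  case 0
  interpret monoid "galois_group \<iota>"
    using group_galois_group by (rule group.is_monoid)
  show ?case
    using one_closed by (simp add: galois_group_def id_def)
next
  case (Suc i)
  interpret monoid "galois_group \<iota>"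
    using group_galois_group by (rule group.is_monoid)
  show ?case
    using m_closed[of \<theta> "\<theta> ^^ i"] automorphism Suc by (simp add: galois_group_def o_def)
qed

lemma funpow_hom: "field_hom (\<theta> ^^ i)"
  using funpow_automorphism by (simp add: ext_auts_def)

lemma funpow_base [simp]: "(\<theta> ^^ i) (\<iota> a) = \<iota> a"
  by (induction i) auto

lemma funpow_y: "(\<theta> ^^ i) y = \<iota> \<beta> ^ i * y"
  by (induction i) (simp_all add: \<theta>.hom_mult \<theta>.hom_power \<theta>_y)

lemma funpow_n: "\<theta> ^^ n = id"
proof (rule automorphism_eqI)
  show "id \<in> ext_auts \<iota>"
    using funpow_automorphism[of 0] by (simp add: id_def)
  show "(\<theta> ^^ n) y = id y"
    using \<beta>_power_n by (simp add: funpow_y flip: hom_power)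
qed (rule funpow_automorphism)

lemma automorphism_is_funpow:
  assumes "\<sigma> \<in> ext_auts \<iota>"
  shows "\<exists>i. \<sigma> = \<theta> ^^ i"
proof -
  obtain i where "\<sigma> y = \<iota> \<beta> ^ i * y"
    using automorphism_root[OF assms] by (auto simp: roots_def)
  then have "\<sigma> = \<theta> ^^ i"
    using assms by (intro automorphism_eqI funpow_automorphism) (simp_all add: funpow_y)
  then show ?thesis ..
qed

lemma generate_galois_group: "generate (galois_group \<iota>) {\<theta>} = carrier (galois_group \<iota>)"
proof
  interpret group "galois_group \<iota>" by (rule group_galois_group)
  show "generate (galois_group \<iota>) {\<theta>} \<subseteq> carrier (galois_group \<iota>)"
    using automorphism by (intro generate_incl) (simp add: galois_group_def)
  have "\<theta> ^^ i \<in> generate (galois_group \<iota>) {\<theta>}" for i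
  proof (induction i)
    case 0
    show ?case
      using generate.one[of "galois_group \<iota>" "{\<theta>}"] by (simp add: galois_group_def id_def)
  next
    case (Suc i)
    show ?case
      using generate.eng[OF generate.incl[of \<theta> "{\<theta>}"] Suc] by (simp add: galois_group_def o_def)
  qed
  then show "carrier (galois_group \<iota>) \<subseteq> generate (galois_group \<iota>) {\<theta>}"
    using automorphism_is_funpow by (auto simp: galois_group_def)
qed

lemma cyclic_galois_group: "cyclic_group (galois_group \<iota>)"
  unfolding cyclic_group_def
proof
  show mem: "\<theta> \<in> carrier (galois_group \<iota>)"
    using automorphism by (simp add: galois_group_def)
  show "subgroup_generated (galois_group \<iota>) {\<theta>} = galois_group \<iota>"
    using mem generate_galois_group by (simp add: subgroup_generated_def)
qed

text \<open>\<theta> multiplies the coordinate at \<open>y ^ j\<close> by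
  \<open>\<beta> ^ j\<close>, which differs from 1 for 0 < j < n. Only the constant coordinate of a
  fixed element survives.\<close>

lemma fixed_imp_base:
  assumes "\<theta> z = z"
  shows "z = \<iota> (coord z 0)"
proof -
  have "z = \<theta> (\<Sum>j<n. \<iota> (coord z j) * y ^ j)"
    using assms by (simp add: coord_sum)
  also have "\<dots> = (\<Sum>j<n. \<iota> (coord z j * \<beta> ^ j) * y ^ j)"
    by (simp add: \<theta>.hom_sum \<theta>.hom_mult \<theta>.hom_power \<theta>_y power_mult_distrib hom_mult hom_power mult_ac)
  finally have eq: "coord z j = coord z j * \<beta> ^ j" if "j < n" for j
    using coord_eqI[of z "\<lambda>j. coord z j * \<beta> ^ j" j] that by blast
  have "coord z j = 0" if "j < n" "j \<noteq> 0" for j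
    using eq[OF that(1)] \<beta>_power_neq_1[of j] that by simp
  then have "(\<Sum>j<n. \<iota> (coord z j) * y ^ j) = (\<Sum>j\<in>{0}. \<iota> (coord z j) * y ^ j)"
    using n_pos by (intro sum.mono_neutral_right) auto
  then show ?thesis
    by (simp add: coord_sum)
qed

section \<open>Conjugates, normality and separability\<close>

definition conjugates :: "'b \<Rightarrow> 'b set" where
  "conjugates z = range (\<lambda>i. (\<theta> ^^ i) z)"

lemma finite_conjugates: "finite (conjugates z)"
proof -
  have mod: "(\<theta> ^^ i) z = (\<theta> ^^ (i mod n)) z" for i
  proof -
    have "\<theta> ^^ i = (\<theta> ^^ n) ^^ (i div n) \<circ> \<theta> ^^ (i mod n)"
      unfolding funpow_mult funpow_add[symmetric] by simp
    then show ?thesis by (simp add: funpow_n)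
  qed
  have "conjugates z \<subseteq> (\<lambda>i. (\<theta> ^^ i) z) ` {..<n}"
  proof
    fix x assume "x \<in> conjugates z"
    then obtain i where "x = (\<theta> ^^ i) z" by (auto simp: conjugates_def)
    then show "x \<in> (\<lambda>i. (\<theta> ^^ i) z) ` {..<n}"
      using mod[of i] n_pos by auto
  qed
  then show ?thesis
    by (rule finite_subset) simp
qed

lemma self_in_conjugates: "z \<in> conjugates z"
  unfolding conjugates_def by (rule range_eqI[of _ _ 0]) simp

lemma image_conjugates: "\<theta> ` conjugates z = conjugates z"
proof (rule card_subset_eq)
  show "\<theta> ` conjugates z \<subseteq> conjugates z"
  proof
    fix x assume "x \<in> \<theta> ` conjugates z"
    then obtain i where "x = (\<theta> ^^ Suc i) z" by (auto simp: conjugates_def)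
    then show "x \<in> conjugates z"
      unfolding conjugates_def by (rule range_eqI)
  qed
  show "card (\<theta> ` conjugates z) = card (conjugates z)"
    using \<theta>.inj_f by (intro card_image) (auto intro: inj_on_subset)
qed (rule finite_conjugates)

text \<open>\<theta> permutes the orbit, hence fixes every coefficient of the product, and elements
  fixed by \<theta> lie in \<open>K\<close>.\<close>

lemma conjugates_polynomial:
  obtains P where "map_poly \<iota> P = (\<Prod>a\<in>conjugates z. [:- a, 1:])"
proof -
  define Q where "Q = (\<Prod>a\<in>conjugates z. [:- a, 1:])"
  interpret map_poly_hom: map_poly_idom_hom \<theta> ..
  have "map_poly \<theta> Q = (\<Prod>a\<in>conjugates z. [:- \<theta> a, 1:])"
    by (simp add: Q_def map_poly_hom.hom_prod map_poly_pCons \<theta>.hom_uminus)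
  also have "\<dots> = (\<Prod>a\<in>\<theta> ` conjugates z. [:- a, 1:])"
    using \<theta>.inj_f by (subst prod.reindex) (auto intro: inj_on_subset)
  finally have "map_poly \<theta> Q = Q"
    by (simp add: image_conjugates Q_def)
  then have "\<theta> (coeff Q i) = coeff Q i" for i
    by (metis \<theta>.coeff_map_poly_hom)
  then have *: "\<iota> (coord (coeff Q i) 0) = coeff Q i" for i
    using fixed_imp_base by metis
  define P where "P = map_poly (\<lambda>c. coord c 0) Q"
  \<comment> \<open>\<open>coeff_map_poly\<close> requires a map sending 0 to 0; the coefficient
    just beyond the degree supplies this.\<close>
  have "coord 0 0 = 0"
    using *[of "Suc (degree Q)"] by (simp add: coeff_eq_0)
  then have "map_poly \<iota> P = Q"
    by (intro poly_eqI) (simp add: P_def coeff_map_poly *)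
  then show thesis
    using that by (simp add: Q_def)
qed

text \<open>The minimal polynomial of \<open>z\<close> divides the orbit polynomial, and
  \<open>p\<close> is a unit multiple of it. Splitting serves normality; as \<open>S\<close> is a
  set, the linear factors are distinct, which serves separability.\<close>

lemma irreducible_factor_splits:
  assumes "Factorial_Ring.irreducible p" "ext_poly \<iota> p z = 0"
  obtains c S where "S \<subseteq> conjugates z" "map_poly \<iota> p = Polynomial.smult c (\<Prod>a\<in>S. [:- a, 1:])" "c \<noteq> 0"
proof -
  interpret map_poly_hom: map_poly_idom_hom \<iota> ..
  have "p \<noteq> 0" using assms(1) by auto
  obtain m where m: "monic m" "Factorial_Ring.irreducible m"
    "\<And>f. ext_poly \<iota> f z = 0 \<longleftrightarrow> m dvd f"
    using ext_minimal_polynomial[OF \<open>p \<noteq> 0\<close> assms(2)] by blast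
  obtain P where P: "map_poly \<iota> P = (\<Prod>a\<in>conjugates z. [:- a, 1:])"
    by (rule conjugates_polynomial)
  have "ext_poly \<iota> P z = 0"
    using finite_conjugates self_in_conjugates by (auto simp: ext_poly_def P poly_prod)
  then have "m dvd P" using m(3) by blast
  then have "map_poly \<iota> m dvd (\<Prod>a\<in>conjugates z. [:- a, 1:])"
    unfolding P[symmetric] by (auto elim!: dvdE simp: map_poly_hom.hom_mult)
  then obtain S where S: "S \<subseteq> conjugates z" "map_poly \<iota> m = (\<Prod>a\<in>S. [:- a, 1:])"
    using monic_dvd_prod_linear[OF finite_conjugates, of "map_poly \<iota> m"] m(1) by auto
  have "m dvd p" using assms(2) m(3) by blast
  then obtain h where h: "p = m * h" ..
  then have "h dvd 1"
    using assms(1) m(2) by (metis irreducible_def)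
  then obtain c where c: "h = [:c:]" "c \<noteq> 0"
    by (auto simp: poly_dvd_1 elim!: degree_eq_zeroE)
  have "map_poly \<iota> p = Polynomial.smult (\<iota> c) (\<Prod>a\<in>S. [:- a, 1:])"
    unfolding h c S(2)[symmetric] by (simp add: hom_distribs map_poly_hom.hom_mult)
  then show thesis
    using that S(1) c by auto
qed

lemma algebraic: "\<exists>p. p \<noteq> 0 \<and> ext_poly \<iota> p z = 0"
proof -
  obtain P where P: "map_poly \<iota> P = (\<Prod>a\<in>conjugates z. [:- a, 1:])"
    by (rule conjugates_polynomial)
  have "(\<Prod>a\<in>conjugates z. [:- a, 1:]) \<noteq> 0"
    using finite_conjugates by (subst prod_zero_iff) auto
  then have "P \<noteq> 0" using P by auto
  moreover have "ext_poly \<iota> P z = 0"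
    using finite_conjugates self_in_conjugates by (auto simp: ext_poly_def P poly_prod)
  ultimately show ?thesis by blast
qed

lemma normal_extension: "normal_ext \<iota>"
  unfolding normal_ext_def
proof (intro conjI allI impI)
  show "\<exists>p. p \<noteq> 0 \<and> ext_poly \<iota> p z = 0" for z
    by (rule algebraic)
  fix p assume p: "Factorial_Ring.irreducible p" "\<exists>z. ext_poly \<iota> p z = 0"
  then obtain z where "ext_poly \<iota> p z = 0" by blast
  then obtain c S where S: "S \<subseteq> conjugates z" "map_poly \<iota> p = Polynomial.smult c (\<Prod>a\<in>S. [:- a, 1:])"
    by (rule irreducible_factor_splits[OF p(1)])
  then have "finite S"
    using finite_conjugates finite_subset by blast
  then obtain zs where "set zs = S" "distinct zs"
    using finite_distinct_list by blast
  then have "map_poly \<iota> p = Polynomial.smult c (\<Prod>a\<leftarrow>zs. [:- a, 1:])"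
    using S(2) \<open>set zs = S\<close> prod.distinct_set_conv_list[OF \<open>distinct zs\<close>, of "\<lambda>a. [:- a, 1:]"]
    by simp
  then show "\<exists>a zs. map_poly \<iota> p = Polynomial.smult a (\<Prod>z\<leftarrow>zs. [:- z, 1:])"
    by blast
qed

lemma separable_extension: "separable_ext \<iota>"
  unfolding separable_ext_def
proof
  fix z
  obtain p where p: "p \<noteq> 0" "ext_poly \<iota> p z = 0" using algebraic by blast
  obtain m where m: "monic m" "Factorial_Ring.irreducible m"
    "\<And>f. ext_poly \<iota> f z = 0 \<longleftrightarrow> m dvd f"
    using ext_minimal_polynomial[OF p] by blast
  have root: "ext_poly \<iota> m z = 0" by (simp add: m(3))
  obtain c S where S: "S \<subseteq> conjugates z"
    "map_poly \<iota> m = Polynomial.smult c (\<Prod>a\<in>S. [:- a, 1:])" "c \<noteq> 0"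
    by (rule irreducible_factor_splits[OF m(2) root])
  have "finite S"
    using S(1) finite_conjugates finite_subset by blast
  have "z \<in> S"
    using root S(2,3) \<open>finite S\<close> by (auto simp: ext_poly_def poly_prod)
  have "poly (pderiv (\<Prod>a\<in>S. [:- a, 1:])) z = (\<Sum>a\<in>S. \<Prod>b\<in>S - {a}. z - b)"
    by (simp add: pderiv_prod poly_sum poly_prod pderiv_pCons)
  \<comment> \<open>Every summand with \<open>a\<close> different from \<open>z\<close> still
    contains the factor \<open>z - z\<close>.\<close>
  also have "\<dots> = (\<Sum>a\<in>{z}. \<Prod>b\<in>S - {a}. z - b)"
    using \<open>finite S\<close> \<open>z \<in> S\<close> by (intro sum.mono_neutral_right) (auto intro!: prod_zero)
  also have "\<dots> \<noteq> 0"
    using \<open>finite S\<close> by (simp add: prod_zero_iff)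
  finally have "poly (pderiv (map_poly \<iota> m)) z \<noteq> 0"
    using S(2,3) by (simp add: pderiv_smult)
  then have "ext_poly \<iota> (pderiv m) z \<noteq> 0"
    by (simp add: ext_poly_def map_poly_pderiv)
  then have "\<not> m dvd pderiv m"
    by (simp add: m(3))
  \<comment> \<open>A common divisor of an irreducible \<open>m\<close> and its derivative is a unit
    or is divisible by \<open>m\<close>, and the latter would make \<open>m\<close> divide the
    derivative.\<close>
  then have "coprime m (pderiv m)"
    using m(2) by (auto intro!: coprimeI dest: Factorial_Ring.irreducibleD' dvd_trans)
  then show "\<exists>p. Factorial_Ring.irreducible p \<and> ext_poly \<iota> p z = 0 \<and> coprime p (pderiv p)"
    using m(2) root by blast
qed

lemma galois_extension: "galois_ext \<iota>"
  using field_hom_axioms finite_extension normal_extension separable_extension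
  by (simp add: galois_ext_def)


subsection \<open>The codes of the generator matrices\<close>

text \<open>Evaluation of a skew polynomial in \<theta> of degree below \<kappa> with coefficients
  in \<open>L\<close>, the analogue of message polynomials for Gabidulin codes.\<close>

definition operator :: "nat \<Rightarrow> (nat \<Rightarrow> 'b) \<Rightarrow> 'b \<Rightarrow> 'b" where
  "operator \<kappa> a z = (\<Sum>i<\<kappa>. a i * (\<theta> ^^ i) z)"

definition base_linear :: "('b \<Rightarrow> 'a) \<Rightarrow> bool" where
  "base_linear f \<longleftrightarrow> (\<forall>w z. f (w + z) = f w + f z) \<and> (\<forall>c z. f (\<iota> c * z) = c * f z)"

lemma base_linear_combination:
  fixes m :: nat
  assumes "base_linear f"
  shows "f (\<Sum>j<m. \<iota> (v j) * w j) = (\<Sum>j<m. v j * f (w j))"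
proof -
  have "f 0 = 0"
    using assms unfolding base_linear_def by (metis hom_zero mult_zero_left)
  then show ?thesis
    by (induction m) (use assms in \<open>auto simp: base_linear_def\<close>)
qed

lemma coord_add: "j < n \<Longrightarrow> coord (w + z) j = coord w j + coord z j"
  by (rule coord_eqI) (simp_all add: hom_add distrib_right sum.distrib coord_sum)

lemma coord_scale: "j < n \<Longrightarrow> coord (\<iota> c * z) j = c * coord z j"
  by (rule coord_eqI) (simp_all add: hom_mult mult.assoc sum_distrib_left[symmetric] coord_sum)

lemma coord_0: "j < n \<Longrightarrow> coord 0 j = 0"
  by (rule coord_eqI) simp_all

lemma base_linear_coord: "base_linear (\<lambda>z. coord z 0)"
  using n_pos by (auto simp: base_linear_def coord_add coord_scale)

lemma operator_combination:
  fixes m :: nat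
  shows "operator \<kappa> a (\<Sum>j<m. \<iota> (v j) * w j) = (\<Sum>j<m. \<iota> (v j) * operator \<kappa> a (w j))"
proof -
  have "(\<theta> ^^ i) (\<Sum>j<m. \<iota> (v j) * w j) = (\<Sum>j<m. \<iota> (v j) * (\<theta> ^^ i) (w j))" for i
  proof -
    interpret f: field_hom "\<theta> ^^ i" by (rule funpow_hom)
    show ?thesis by (simp add: f.hom_sum f.hom_mult)
  qed
  then have "operator \<kappa> a (\<Sum>j<m. \<iota> (v j) * w j) =
      (\<Sum>i<\<kappa>. \<Sum>j<m. \<iota> (v j) * (a i * (\<theta> ^^ i) (w j)))"
    by (simp add: operator_def sum_distrib_left mult_ac)
  also have "\<dots> = (\<Sum>j<m. \<iota> (v j) * operator \<kappa> a (w j))"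
    by (subst sum.swap) (simp add: operator_def sum_distrib_left)
  finally show ?thesis .
qed

text \<open>A nonzero operator of \<open>\<theta>\<close>-degree below \<open>\<kappa>\<close> has a kernel of \<open>K\<close>-dimension at most \<open>\<kappa> - 1\<close>,
  stated as: \<open>\<kappa> - 1\<close> linear functionals separate the kernel from \<open>0\<close>. After scaling a kernel
  element to \<open>1\<close>, the operator factors through \<open>\<theta> - 1\<close>, whose kernel is \<open>K\<close>.\<close>

lemma operator_kernel:
  assumes "i < \<kappa>" "a i \<noteq> 0"
  shows "\<exists>F. (\<forall>f\<in>set F. base_linear f) \<and> length F = \<kappa> - 1 \<and>
    (\<forall>z. operator \<kappa> a z = 0 \<longrightarrow> (\<forall>f\<in>set F. f z = 0) \<longrightarrow> z = 0)"
  using assms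
proof (induction \<kappa> arbitrary: a i)
  case (Suc \<kappa>)
  show ?case
  proof (cases "\<exists>z. z \<noteq> 0 \<and> operator (Suc \<kappa>) a z = 0")
    case False
    have "base_linear (\<lambda>_. 0)" by (simp add: base_linear_def)
    \<comment> \<open>The kernel is already trivial; zero functionals only pad the list to the
      required length.\<close>
    with False show ?thesis
      by (intro exI[of _ "replicate \<kappa> (\<lambda>_. 0)"]) auto
  next
    case True
    then obtain z0 where z0: "z0 \<noteq> 0" "operator (Suc \<kappa>) a z0 = 0" by blast
    \<comment> \<open>\<open>c\<close> holds the coefficients of the operator precomposed with
      multiplication by \<open>z0\<close>; \<open>b\<close> holds those of its quotient by \<theta>
      - 1.\<close>
    define c where "c i = a i * (\<theta> ^^ i) z0" for i
    define b where "b i = - (\<Sum>j<Suc i. c j)" for i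
    have c_nonzero: "c i \<noteq> 0"
    proof -
      interpret f: field_hom "\<theta> ^^ i" by (rule funpow_hom)
      show ?thesis using Suc.prems z0 by (simp add: c_def)
    qed
    \<comment> \<open>The rescaled operator kills 1, so its coefficients sum to zero and the
      remainder in \<open>abel_summation\<close> cancels the term of index \<kappa>.\<close>
    have total: "(\<Sum>j<\<kappa>. c j) = - c \<kappa>"
      using z0(2) by (simp add: operator_def c_def eq_neg_iff_add_eq_0)
    have factor: "operator (Suc \<kappa>) a (z0 * w) = operator \<kappa> b (\<theta> w - w)" for w
    proof -
      have "(\<theta> ^^ i) (z0 * w) = (\<theta> ^^ i) z0 * (\<theta> ^^ i) w" for i
      proof -
        interpret f: field_hom "\<theta> ^^ i" by (rule funpow_hom)
        show ?thesis by (rule f.hom_mult)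
      qed
      then have "operator (Suc \<kappa>) a (z0 * w) = (\<Sum>i<\<kappa>. c i * (\<theta> ^^ i) w) - (\<Sum>j<\<kappa>. c j) * (\<theta> ^^ \<kappa>) w"
        unfolding total by (simp add: operator_def c_def mult.assoc)
      also have "\<dots> = (\<Sum>i<\<kappa>. b i * ((\<theta> ^^ Suc i) w - (\<theta> ^^ i) w))"
        unfolding b_def by (rule abel_summation[symmetric])
      also have "\<dots> = operator \<kappa> b (\<theta> w - w)"
        unfolding operator_def
      proof (intro sum.cong refl)
        fix i
        interpret f: field_hom "\<theta> ^^ i" by (rule funpow_hom)
        show "b i * ((\<theta> ^^ Suc i) w - (\<theta> ^^ i) w) = b i * (\<theta> ^^ i) (\<theta> w - w)"
          unfolding f.hom_minus by (simp add: funpow_swap1)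
      qed
      finally show ?thesis .
    qed
    \<comment> \<open>If all partial sums vanished, so would every \<open>c i\<close>, including the
      one known to be nonzero.\<close>
    have "\<exists>k<\<kappa>. b k \<noteq> 0"
    proof (rule ccontr)
      assume "\<not> ?thesis"
      then have b0: "b k = 0" if "k < \<kappa>" for k using that by blast
      have partial: "(\<Sum>j<k. c j) = 0" if "k \<le> \<kappa>" for k
      proof (cases k)
        case (Suc k')
        then show ?thesis
          using b0[of k'] that unfolding b_def Suc neg_equal_0_iff_equal by (simp only: Suc_le_eq)
      qed simp
      show False
      proof (cases "i = \<kappa>")
        case True
        then show ?thesis using total partial[of \<kappa>] c_nonzero by simp
      next
        case False
        then have "i < \<kappa>" using Suc.prems by simp
        then show ?thesis using partial[of i] partial[of "Suc i"] c_nonzero by simp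
      qed
    qed
    then obtain k where k: "k < \<kappa>" "b k \<noteq> 0" by blast
    obtain F where F: "\<And>f. f \<in> set F \<Longrightarrow> base_linear f" "length F = \<kappa> - 1"
      "\<And>z. operator \<kappa> b z = 0 \<Longrightarrow> (\<forall>f\<in>set F. f z = 0) \<Longrightarrow> z = 0"
      using Suc.IH[of k b, OF k] by blast
    \<comment> \<open>The functionals of \<open>F\<close> are pulled back along w \<mapsto> \<theta>
      w - w with \<open>w = z / z0\<close>. If they vanish on a kernel element, then
      \<open>w\<close> lies in \<open>K\<close>, and the additional constant coordinate detects
      it.\<close>
    define F' where "F' = (\<lambda>z. coord (z / z0) 0) # map (\<lambda>f z. f (\<theta> (z / z0) - z / z0)) F"
    have "base_linear f" if "f \<in> set F'" for f
    proof -
      consider "f = (\<lambda>z. coord (z / z0) 0)"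
        | g where "g \<in> set F" "f = (\<lambda>z. g (\<theta> (z / z0) - z / z0))"
        using \<open>f \<in> set F'\<close> by (auto simp: F'_def)
      then show ?thesis
      proof cases
        case 1
        then show ?thesis
          using base_linear_coord by (simp add: base_linear_def add_divide_distrib flip: times_divide_eq_right)
      next
        case 2
        have "\<theta> ((w + z) / z0) - (w + z) / z0 = (\<theta> (w / z0) - w / z0) + (\<theta> (z / z0) - z / z0)" for w z
          by (simp add: add_divide_distrib \<theta>.hom_add)
        moreover have "\<theta> (\<iota> e * z / z0) - \<iota> e * z / z0 = \<iota> e * (\<theta> (z / z0) - z / z0)" for e z
          unfolding times_divide_eq_right[symmetric] \<theta>.hom_mult \<theta>_base by (rule right_diff_distrib[symmetric])
        ultimately show ?thesis
          using F(1)[OF 2(1)] unfolding 2(2) base_linear_def by simp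
      qed
    qed
    moreover have "length F' = Suc \<kappa> - 1"
      \<comment> \<open>Here \<open>k < \<kappa>\<close> ensures that \<kappa> is positive, so the
        truncated \<open>\<kappa> - 1\<close> plus one is \<kappa>.\<close>
      using k F(2) by (simp add: F'_def)
    moreover have "z = 0" if z: "operator (Suc \<kappa>) a z = 0" "\<forall>f\<in>set F'. f z = 0" for z
    proof -
      define w where "w = z / z0"
      have "z = z0 * w" using z0 by (simp add: w_def)
      then have "operator \<kappa> b (\<theta> w - w) = 0" using z(1) factor by simp
      moreover have "\<forall>f\<in>set F. f (\<theta> w - w) = 0"
        using z(2) by (auto simp: F'_def w_def)
      ultimately have "\<theta> w - w = 0" by (rule F(3))
      then have "w = \<iota> (coord w 0)"
        by (intro fixed_imp_base) simp
      also have "coord w 0 = 0"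
        using z(2) by (auto simp: F'_def w_def)
      finally show ?thesis
        using \<open>z = z0 * w\<close> by simp
    qed
    ultimately show ?thesis by blast
  qed
qed simp

lemma combination_vec_eq_0_imp:
  fixes v :: "'a vec"
  assumes "v \<in> carrier_vec n" "(\<Sum>j<n. \<iota> (v $ j) * y ^ j) = 0"
  shows "v = 0\<^sub>v n"
  using assms combination_eq_0_imp by (intro eq_vecI) auto

text \<open>An operator vanishing on the power basis vanishes on all of \<open>L\<close>, but
  \<open>\<kappa> - 1 < n\<close> functionals cannot separate an \<open>n\<close>-dimensional space
  from 0.\<close>

lemma operator_eq_0_imp:
  assumes "\<kappa> \<le> n" "\<And>j. j < n \<Longrightarrow> operator \<kappa> a (y ^ j) = 0" "i < \<kappa>"
  shows "a i = 0"
proof (rule ccontr)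
  assume "a i \<noteq> 0"
  from operator_kernel[of i \<kappa> a, OF assms(3) this] obtain F where
    F: "\<And>f. f \<in> set F \<Longrightarrow> base_linear f" "length F = \<kappa> - 1"
      "\<And>z. operator \<kappa> a z = 0 \<Longrightarrow> (\<forall>f\<in>set F. f z = 0) \<Longrightarrow> z = 0"
    by blast
  define ws where "ws = map (\<lambda>f. vec n (\<lambda>j. f (y ^ j))) F"
  have "set ws \<subseteq> carrier_vec n" "length ws < n"
    using F(2) assms by (auto simp: ws_def)
  then obtain v where v: "v \<in> carrier_vec n" "v \<noteq> 0\<^sub>v n" "\<And>w. w \<in> set ws \<Longrightarrow> w \<bullet> v = 0"
    using orthogonal_vec_exists by blast
  define z where "z = (\<Sum>j<n. \<iota> (v $ j) * y ^ j)"
  have "operator \<kappa> a z = 0"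
    unfolding z_def operator_combination using assms(2) by simp
  moreover have "f z = 0" if f: "f \<in> set F" for f
  proof -
    have "f z = vec n (\<lambda>j. f (y ^ j)) \<bullet> v"
      unfolding z_def base_linear_combination[OF F(1)[OF f]]
      using v(1) by (simp add: scalar_prod_def atLeast0LessThan mult.commute)
    then show ?thesis
      using v(3) f by (simp add: ws_def)
  qed
  ultimately have "z = 0" using F(3) by blast
  then show False
    using combination_vec_eq_0_imp[OF v(1)] v(2) by (simp add: z_def)
qed

section \<open>Codewords, their coordinate matrices and their ranks\<close>

definition code :: "nat \<Rightarrow> 'b vec set" where
  "code \<kappa> = generated_code n (generator_mat \<theta> y \<kappa> n)"

definition codeword :: "nat \<Rightarrow> (nat \<Rightarrow> 'b) \<Rightarrow> 'b vec" where
  "codeword \<kappa> a = vec n (\<lambda>j. operator \<kappa> a (y ^ j))"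

lemma generator_carrier: "generator_mat \<theta> y \<kappa> n \<in> carrier_mat \<kappa> n"
  by (simp add: generator_mat_def)

lemma transpose_generator_mult:
  assumes "v \<in> carrier_vec \<kappa>"
  shows "(generator_mat \<theta> y \<kappa> n)\<^sup>T *\<^sub>v v = codeword \<kappa> (\<lambda>i. v $ i)"
  using assms
  by (intro eq_vecI)
     (auto simp: generator_mat_def codeword_def operator_def scalar_prod_def atLeast0LessThan mult.commute)

lemma codeword_cong: "(\<And>i. i < \<kappa> \<Longrightarrow> a i = a' i) \<Longrightarrow> codeword \<kappa> a = codeword \<kappa> a'"
  by (auto simp: codeword_def operator_def)

lemma code_eq: "code \<kappa> = range (codeword \<kappa>)"
proof -
  interpret vec_space "TYPE('b)" n .
  have "code \<kappa> = {w \<in> carrier_vec n. \<exists>v\<in>carrier_vec \<kappa>. (generator_mat \<theta> y \<kappa> n)\<^sup>T *\<^sub>v v = w}"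
    unfolding code_def generated_code_def using row_space_eq[OF generator_carrier] generator_carrier[of \<kappa>]
    by auto
  also have "\<dots> = range (codeword \<kappa>)"
  proof (intro equalityI subsetI)
    fix w assume "w \<in> range (codeword \<kappa>)"
    then obtain a where w: "w = codeword \<kappa> a" by blast
    have "codeword \<kappa> a = codeword \<kappa> (\<lambda>i. vec \<kappa> a $ i)"
      by (rule codeword_cong) simp
    then show "w \<in> {w \<in> carrier_vec n. \<exists>v\<in>carrier_vec \<kappa>. (generator_mat \<theta> y \<kappa> n)\<^sup>T *\<^sub>v v = w}"
      using transpose_generator_mult[of "vec \<kappa> a" \<kappa>] w
      by (auto intro!: bexI[of _ "vec \<kappa> a"] simp: codeword_def)
  qed (auto simp: transpose_generator_mult)
  finally show ?thesis .
qed

lemma codeword_eq_0_imp: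
  assumes "\<kappa> \<le> n" "codeword \<kappa> a = 0\<^sub>v n" "i < \<kappa>"
  shows "a i = 0"
proof (rule operator_eq_0_imp[OF assms(1) _ assms(3)])
  fix j assume "j < n"
  then show "operator \<kappa> a (y ^ j) = 0"
    using arg_cong[OF assms(2), of "\<lambda>w :: 'b vec. w $ j"] by (simp add: codeword_def)
qed

lemma coord_mat_eq: "coord_mat \<iota> y n c = mat n n (\<lambda>(i, j). coord (c $ i) j)"
  unfolding coord_mat_def
proof (rule the_equality)
  fix M assume M: "M \<in> carrier_mat n n \<and> (\<forall>i<n. c $ i = (\<Sum>j<n. \<iota> (M $$ (i, j)) * y ^ j))"
  then show "M = mat n n (\<lambda>(i, j). coord (c $ i) j)"
    by (intro eq_matI) (auto intro!: coord_eqI[symmetric])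
qed (simp add: coord_sum)

text \<open>A vector \<open>v\<close> orthogonal to all columns of the coordinate matrix is the
  coordinate vector of a kernel element of the operator. The functionals of
  \<open>operator_kernel\<close> then serve as the extra constraints in
  \<open>le_rank_plus_constraints\<close>.\<close>

lemma rank_codeword_ge:
  assumes "i < \<kappa>" "a i \<noteq> 0"
  shows "n \<le> vec_space.rank n (coord_mat \<iota> y n (codeword \<kappa> a)) + (\<kappa> - 1)"
proof -
  obtain F where
    F: "\<And>f. f \<in> set F \<Longrightarrow> base_linear f" "length F = \<kappa> - 1"
      "\<And>z. operator \<kappa> a z = 0 \<Longrightarrow> (\<forall>f\<in>set F. f z = 0) \<Longrightarrow> z = 0"
    using operator_kernel[of i \<kappa> a, OF assms] by blast
  \<comment> \<open>Each functional is recorded by its values on the power basis, so that pairing it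
    with the coordinates of \<open>z\<close> gives \<open>f z\<close>.\<close>
  define ws where "ws = map (\<lambda>f. vec n (\<lambda>j. f (y ^ j))) F"
  define M where "M = coord_mat \<iota> y n (codeword \<kappa> a)"
  have M: "M \<in> carrier_mat n n"
    by (simp add: M_def coord_mat_eq)
  have "n \<le> vec_space.rank n M + length ws"
  proof (rule vec_space.le_rank_plus_constraints[OF M])
    show "set ws \<subseteq> carrier_vec n" by (auto simp: ws_def)
    fix v assume v: "v \<in> carrier_vec n" "\<And>w. w \<in> set ws \<Longrightarrow> w \<bullet> v = 0"
      "\<And>j. j < n \<Longrightarrow> col M j \<bullet> v = 0"
    define z where "z = (\<Sum>j<n. \<iota> (v $ j) * y ^ j)"
    have "operator \<kappa> a z = (\<Sum>j<n. \<iota> (v $ j) * codeword \<kappa> a $ j)"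
      unfolding z_def operator_combination by (simp add: codeword_def)
    also have "\<dots> = (\<Sum>j<n. \<iota> (v $ j) * (\<Sum>l<n. \<iota> (M $$ (j, l)) * y ^ l))"
      by (intro sum.cong refl) (simp add: M_def coord_mat_eq coord_sum)
    also have "\<dots> = (\<Sum>l<n. \<Sum>j<n. \<iota> (v $ j * M $$ (j, l)) * y ^ l)"
      unfolding sum_distrib_left by (subst sum.swap) (simp add: hom_mult mult.assoc)
    also have "\<dots> = (\<Sum>l<n. \<iota> (col M l \<bullet> v) * y ^ l)"
      using v(1) M
      by (intro sum.cong refl)
         (simp add: scalar_prod_def atLeast0LessThan mult.commute hom_sum sum_distrib_left)
    also have "\<dots> = 0"
      using v(3) by simp
    finally have "operator \<kappa> a z = 0" .
    moreover have "f z = 0" if f: "f \<in> set F" for f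
    proof -
      have "f z = vec n (\<lambda>j. f (y ^ j)) \<bullet> v"
        unfolding z_def base_linear_combination[OF F(1)[OF f]]
        using v(1) by (simp add: scalar_prod_def atLeast0LessThan mult.commute)
      then show ?thesis
        using v(2) f by (simp add: ws_def)
    qed
    ultimately have "z = 0" using F(3) by blast
    then show "v = 0\<^sub>v n"
      using combination_vec_eq_0_imp[OF v(1)] by (simp add: z_def)
  qed
  then show ?thesis
    using F(2) by (simp add: ws_def M_def)
qed

lemma rank_ge:
  assumes "\<kappa> \<le> n" "c \<in> code \<kappa>" "c \<noteq> 0\<^sub>v n"
  shows "vec_space.rank n (coord_mat \<iota> y n c) \<ge> n - \<kappa> + 1"
proof -
  obtain a where c: "c = codeword \<kappa> a"
    using assms(2) by (auto simp: code_eq)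
  have "\<exists>i<\<kappa>. a i \<noteq> 0"
  proof (rule ccontr)
    assume "\<not> ?thesis"
    then have "c = 0\<^sub>v n"
      unfolding c by (intro eq_vecI) (auto simp: codeword_def operator_def)
    then show False using assms(3) by simp
  qed
  then obtain i where "i < \<kappa>" "a i \<noteq> 0" by blast
  from rank_codeword_ge[of i \<kappa> a, OF this] show ?thesis
    using assms(1) \<open>i < \<kappa>\<close> unfolding c by linarith
qed

text \<open>Requiring the first \<open>\<kappa> - 1\<close> entries to vanish is one condition fewer
  than the \<kappa> free coefficients. The resulting zero rows leave at most
  \<open>n - (\<kappa> - 1)\<close> for the rank.\<close>

lemma codeword_of_rank_le_exists:
  assumes "1 \<le> \<kappa>" "\<kappa> \<le> n"
  obtains c where "c \<in> code \<kappa>" "c \<noteq> 0\<^sub>v n" "vec_space.rank n (coord_mat \<iota> y n c) \<le> n - \<kappa> + 1"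
proof -
  define ws where "ws = map (\<lambda>j. vec \<kappa> (\<lambda>i. (\<theta> ^^ i) (y ^ j))) [0..<\<kappa> - 1]"
  have "set ws \<subseteq> carrier_vec \<kappa>" "length ws < \<kappa>"
    using assms by (auto simp: ws_def)
  then obtain v where v: "v \<in> carrier_vec \<kappa>" "v \<noteq> 0\<^sub>v \<kappa>" "\<And>w. w \<in> set ws \<Longrightarrow> w \<bullet> v = 0"
    using orthogonal_vec_exists by blast
  define c where "c = codeword \<kappa> (\<lambda>i. v $ i)"
  have zero: "operator \<kappa> (\<lambda>i. v $ i) (y ^ j) = 0" if "j < \<kappa> - 1" for j
  proof -
    have "operator \<kappa> (\<lambda>i. v $ i) (y ^ j) = vec \<kappa> (\<lambda>i. (\<theta> ^^ i) (y ^ j)) \<bullet> v"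
      using v(1) by (simp add: operator_def scalar_prod_def atLeast0LessThan mult.commute)
    also have "\<dots> = 0"
      using that by (intro v(3)) (auto simp: ws_def)
    finally show ?thesis .
  qed
  have "c \<noteq> 0\<^sub>v n"
  proof
    assume "c = 0\<^sub>v n"
    then have "v $ i = 0" if "i < \<kappa>" for i
      using codeword_eq_0_imp[OF assms(2), of "\<lambda>i. v $ i" i] that by (simp add: c_def)
    then have "v = 0\<^sub>v \<kappa>"
      using v(1) by (intro eq_vecI) auto
    then show False using v(2) by simp
  qed
  moreover have "vec_space.rank n (coord_mat \<iota> y n c) \<le> n - (\<kappa> - 1)"
  proof (rule vec_space.rank_zero_rows_le)
    show "coord_mat \<iota> y n c \<in> carrier_mat n n"
      by (simp add: coord_mat_eq)
    show "coord_mat \<iota> y n c $$ (i, j) = 0" if "i < \<kappa> - 1" "j < n" for i j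
      using that assms zero[of i] by (simp add: coord_mat_eq c_def codeword_def coord_0)
  qed (use assms in simp)
  moreover have "n - (\<kappa> - 1) = n - \<kappa> + 1"
    using assms by simp
  ultimately show thesis
    using that[of c] by (simp add: code_eq c_def)
qed

lemma linear_code: "linear_code n (code \<kappa>)"
proof -
  interpret vec_space "TYPE('b)" n .
  have "set (rows (generator_mat \<theta> y \<kappa> n)) \<subseteq> carrier_vec n"
    using generator_carrier[of \<kappa>] rows_carrier[of "generator_mat \<theta> y \<kappa> n"] by simp
  then show ?thesis
    unfolding linear_code_def code_def generated_code_def row_space_def
    by (intro span_is_subspace) simp
qed

text \<open>Encoding is injective, so the rows of the generator matrix are independent; the
  dimension is read off as the rank of the transpose.\<close>

lemma code_dimension:
  assumes "\<kappa> \<le> n"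
  shows "code_dim n (code \<kappa>) = \<kappa>"
proof -
  interpret vec_space "TYPE('b)" n .
  define A where "A = (generator_mat \<theta> y \<kappa> n)\<^sup>T"
  have A: "A \<in> carrier_mat n \<kappa>"
    using generator_carrier by (simp add: A_def)
  have inj: "v = 0\<^sub>v \<kappa>" if v: "v \<in> carrier_vec \<kappa>" "A *\<^sub>v v = 0\<^sub>v n" for v
    using codeword_eq_0_imp[OF assms, of "\<lambda>i. v $ i"] v
    by (intro eq_vecI) (auto simp: A_def transpose_generator_mult)
  have mult_unit: "A *\<^sub>v unit_vec \<kappa> i = col A i" if "i < \<kappa>" for i
    using that A by (intro eq_vecI) auto
  \<comment> \<open>Independence concerns the set of columns, so repeated columns must be excluded
    separately; two equal ones would put a difference of unit vectors into the kernel.\<close>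
  have "distinct (cols A)"
    unfolding distinct_conv_nth
  proof (intro allI impI notI)
    fix i j assume ij: "i < length (cols A)" "j < length (cols A)" "i \<noteq> j" "cols A ! i = cols A ! j"
    then have lt: "i < \<kappa>" "j < \<kappa>" using A by auto
    then have "col A i = col A j" using ij A by simp
    then have "A *\<^sub>v unit_vec \<kappa> i = A *\<^sub>v unit_vec \<kappa> j"
      using lt A mult_unit by simp
    then have "A *\<^sub>v (unit_vec \<kappa> i - unit_vec \<kappa> j) = 0\<^sub>v n"
      using A by (subst mult_minus_distrib_mat_vec[of _ n \<kappa>]) auto
    then have "unit_vec \<kappa> i - unit_vec \<kappa> j = (0\<^sub>v \<kappa> :: 'b vec)"
      by (intro inj) auto
    then have "(unit_vec \<kappa> i - unit_vec \<kappa> j) $ i = (0\<^sub>v \<kappa> :: 'b vec) $ i"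
      by simp
    then show False using lt ij(3) by simp
  qed
  moreover from this have "lin_indpt (set (cols A))"
    using lin_depE[OF A] inj by metis
  ultimately have "rank A = \<kappa>"
    using lin_indpt_full_rank[OF A] by blast
  then show ?thesis
    by (simp add: rank_def code_dim_def code_def generated_code_def row_space_def A_def)
qed

lemma min_rank_distance_code:
  assumes "1 \<le> \<kappa>" "\<kappa> \<le> n"
  shows "min_rank_distance \<iota> y n (code \<kappa>) = n - \<kappa> + 1"
proof -
  obtain c where c: "c \<in> code \<kappa>" "c \<noteq> 0\<^sub>v n" "vec_space.rank n (coord_mat \<iota> y n c) \<le> n - \<kappa> + 1"
    by (rule codeword_of_rank_le_exists[OF assms])
  then have "rank_weight \<iota> y n c = n - \<kappa> + 1"
    using rank_ge[OF assms(2) c(1,2)] by (simp add: rank_weight_def)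
  then show ?thesis
    \<comment> \<open>The infimum is an attained minimum: the word \<open>c\<close> meets the lower
      bound that \<open>rank_ge\<close> gives for all nonzero words.\<close>
    unfolding min_rank_distance_def
    using c rank_ge[OF assms(2)]
    by (intro cInf_eq_minimum) (force simp: rank_weight_def)+
qed

lemma MRD:
  assumes "1 \<le> \<kappa>" "\<kappa> \<le> n"
  shows "MRD_code \<iota> y n (code \<kappa>)"
proof -
  obtain c where "c \<in> code \<kappa>" "c \<noteq> 0\<^sub>v n"
    using codeword_of_rank_le_exists[OF assms] by blast
  then have "code \<kappa> \<noteq> {0\<^sub>v n}" by blast
  then show ?thesis
    using assms by (simp add: MRD_code_def linear_code min_rank_distance_code code_dimension)
qed

end

section \<open>Transfer to the rational function field\<close>

lemma primitive_root_to_fract: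
  assumes "primitive_root_of_unity n \<alpha>"
  shows "primitive_root_of_unity n (to_fract [:\<alpha>:])"
proof -
  have "to_fract [:\<alpha>:] ^ k = to_fract [:\<alpha> ^ k:]" for k
  proof (induction k)
    case 0
    show ?case by (metis one_pCons power_0 to_fract_1)
  qed (simp flip: to_fract_mult)
  moreover have "to_fract [:a:] = 1 \<longleftrightarrow> a = 1" for a :: 'a
    by (metis one_pCons pCons_eq_iff to_fract_1 to_fract_eq_iff)
  ultimately show ?thesis
    using assms by (simp add: primitive_root_of_unity_def)
qed

theorem mainTheorem1:
  fixes q n :: nat
    and \<alpha> :: "'f::{field,finite}"
    and u :: "'f poly fract"
    and \<iota> :: "'f poly fract \<Rightarrow> 'l::field"
    and y :: 'l
  assumes "q = card (UNIV :: 'f set)"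
    and "n \<ge> 1"
    and "n dvd q - 1"
    and "primitive_root_of_unity n \<alpha>"
    and "u \<noteq> 0"
    and "\<forall>d w. d dvd n \<longrightarrow> d > 1 \<longrightarrow> u \<noteq> w ^ d"
    and "field_hom \<iota>"
    and "y ^ n = \<iota> u"
    and "range (\<lambda>p. ext_poly \<iota> p y) = UNIV"
  shows "galois_ext \<iota> \<and> cyclic_group (galois_group \<iota>) \<and> ext_degree \<iota> = n \<and>
         is_ext_basis \<iota> n (\<lambda>j. y ^ j) \<and>
         (\<exists>!\<theta>. \<theta> \<in> ext_auts \<iota> \<and> \<theta> y = \<iota> (to_fract [:\<alpha>:]) * y) \<and>
         (\<forall>\<theta>. \<theta> \<in> ext_auts \<iota> \<and> \<theta> y = \<iota> (to_fract [:\<alpha>:]) * y \<longrightarrow>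
            generate (galois_group \<iota>) {\<theta>} = carrier (galois_group \<iota>) \<and>
            (\<forall>\<kappa>. 1 \<le> \<kappa> \<and> \<kappa> \<le> n \<longrightarrow>
               (let C = generated_code n (generator_mat \<theta> y \<kappa> n) in
                  MRD_code \<iota> y n C \<and> code_dim n C = \<kappa> \<and>
                  min_rank_distance \<iota> y n C = n - \<kappa> + 1 \<and>
                  (\<forall>c\<in>C. c \<noteq> 0\<^sub>v n \<longrightarrow>
                     vec_space.rank n (coord_mat \<iota> y n c) \<ge> n - \<kappa> + 1))))"
proof -
  interpret field_hom \<iota> by fact
  interpret kummer_extension \<iota> n "to_fract [:\<alpha>:]" u y
    using assms primitive_root_to_fract by unfold_locales blast+
  have aut: "kummer_automorphism \<iota> n (to_fract [:\<alpha>:]) u y \<theta>"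
    if "\<theta> \<in> ext_auts \<iota>" "\<theta> y = \<iota> (to_fract [:\<alpha>:]) * y" for \<theta>
    using that by unfold_locales
  \<comment> \<open>Any one generator supplies the claims about the extension itself; those about
    codes range over all such automorphisms and are proved for an arbitrary \<sigma>.\<close>
  obtain \<theta> where "\<theta> \<in> ext_auts \<iota>" "\<theta> y = \<iota> (to_fract [:\<alpha>:]) * y"
    using ex1_generator by blast
  then interpret \<theta>: kummer_automorphism \<iota> n "to_fract [:\<alpha>:]" u y \<theta>
    by (rule aut)
  have "generate (galois_group \<iota>) {\<sigma>} = carrier (galois_group \<iota>) \<and>
      (\<forall>\<kappa>. 1 \<le> \<kappa> \<and> \<kappa> \<le> n \<longrightarrow>
         (let C = generated_code n (generator_mat \<sigma> y \<kappa> n) in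
            MRD_code \<iota> y n C \<and> code_dim n C = \<kappa> \<and>
            min_rank_distance \<iota> y n C = n - \<kappa> + 1 \<and>
            (\<forall>c\<in>C. c \<noteq> 0\<^sub>v n \<longrightarrow>
               vec_space.rank n (coord_mat \<iota> y n c) \<ge> n - \<kappa> + 1)))"
    if "\<sigma> \<in> ext_auts \<iota> \<and> \<sigma> y = \<iota> (to_fract [:\<alpha>:]) * y" for \<sigma>
  proof -
    interpret \<sigma>: kummer_automorphism \<iota> n "to_fract [:\<alpha>:]" u y \<sigma>
      using that by (intro aut) auto
    show ?thesis
      using \<sigma>.generate_galois_group \<sigma>.MRD \<sigma>.code_dimension \<sigma>.min_rank_distance_code \<sigma>.rank_ge
      unfolding \<sigma>.code_def Let_def by blast
  qed
  then show ?thesis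
    using \<theta>.galois_extension \<theta>.cyclic_galois_group degree_extension power_basis ex1_generator
    by blast
qed

end
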